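(* Let $k\in\mathbb N$, $\mathbf y\in\mathbb R^k$, $N\in\mathbb N$ and $\mathbf d=(d_1,\dots,d_k)\in(0,1/2]^k$, and for each integer $n\in[N,2N)$ let $A_n^*(\cdot)=A_n^*(\cdot;\mathbf d)$. Let $\mu=\mu_1\times\cdots\times\mu_k$ be a product of Borel probability measures on $[0,1]$ with $\dim_{\ell^1}(\mu_j)=\kappa_j$ for each $j$. Then for any $\varepsilon>0$, \[ \Big|\sum_{N\leqslant n<2N}\big(\mu(A_n^* )-\lambda(A_n^* )\big)\Big|\ll_{\varepsilon} N^{k+\varepsilon}\prod_{j=1}^k d_j^{\kappa_j-\varepsilon}, \] where the implied constant depends on $\varepsilon,k,w,\mu$ but not on $N$, $\mathbf d$ or $\mathbf y$.
   Context: Let $w:\mathbb R\to[0,1]$ be a fixed non-zero smooth (Schwartz-class) bump function supported on $[-2,2]$. For $\mathbf d\in(0,1/2]^k$ put $w_{\mathcal R(\mathbf d)}(\mathbf x)=\prod_{j=1}^k w(x_j/d_j)$, and for $n\in\mathbb N$ and fixed $\mathbf y\in\mathbb R^k$ define \[ A_n^*(\mathbf x;\mathbf d)=\sum_{\mathbf a\in\mathbb Z^k}w_{\mathcal R(\mathbf d)}\Big(\mathbf x-\frac{\mathbf a+\mathbf y}{n}\Big). \] $\lambda$ is Lebesgue measure on $[0,1]^k$ and $\nu(f)=\int_{[0,1]^k}f\,d\nu$. For a Borel probability measure $\nu$ on $[0,1]$, $\hat\nu(\xi)=\int e^{-2\pi i\xi x}\,d\nu(x)$ and $\dim_{\ell^1}(\nu)=\sup\{s\geqslant0:\sum_{\xi\in\mathbb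 Z,|\xi|\leqslant Q}|\hat\nu(\xi)|\ll Q^{1-s}\ (Q\geqslant1)\}$. *)

theory Defs
  imports "HOL-Probability.Probability"
begin

definition smooth_real :: "(real \<Rightarrow> real) \<Rightarrow> bool" where
  "smooth_real f \<longleftrightarrow> (\<forall>m. \<forall>x. ((deriv ^^ m) f) differentiable (at x))"

definition fourier_coeff :: "real measure \<Rightarrow> int \<Rightarrow> complex" where
  "fourier_coeff \<nu> \<xi> = (LINT x|\<nu>. cis (- 2 * pi * of_int \<xi> * x))"

definition dim_l1 :: "real measure \<Rightarrow> real" where
  "dim_l1 \<nu> = Sup {s. s \<ge> 0 \<and> (\<exists>C. \<forall>Q::real. Q \<ge> 1 \<longrightarrow>
      (\<Sum>\<xi>\<in>{\<xi>::int. \<bar>real_of_int \<xi>\<bar> \<le> Q}. cmod (fourier_coeff \<nu> \<xi>)) \<le> C * Q powr (1 - s))}"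

definition lattice :: "nat \<Rightarrow> (nat \<Rightarrow> int) set" where
  "lattice k = PiE {..<k} (\<lambda>_. UNIV)"

definition unit_cube :: "nat \<Rightarrow> (nat \<Rightarrow> real) set" where
  "unit_cube k = PiE {..<k} (\<lambda>_. {0..1})"

definition A_star :: "(real \<Rightarrow> real) \<Rightarrow> nat \<Rightarrow> (nat \<Rightarrow> real) \<Rightarrow> (nat \<Rightarrow> real) \<Rightarrow> nat
    \<Rightarrow> (nat \<Rightarrow> real) \<Rightarrow> real" where
  "A_star w k y d n x = (\<Sum>\<^sub>\<infinity>a\<in>lattice k.
      \<Prod>j<k. w ((x j - (of_int (a j) + y j) / real n) / d j))"

definition leb01 :: "real measure" where
  "leb01 = restrict_space lborel {0..1}"

definition cube_integral :: "nat \<Rightarrow> (nat \<Rightarrow> real) measure \<Rightarrow> ((nat \<Rightarrow> real) \<Rightarrow> real) \<Rightarrow> real" where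
  "cube_integral k \<nu> f = (LINT x:unit_cube k|\<nu>. f x)"

end

theory Submission
  imports Defs "HOL-Computational_Algebra.Primes"
begin

text \<open>On the unit cube \<^const>\<open>A_star\<close> factors into one-dimensional sums, each of which Poisson summation
  expands with frequencies in \<open>n \<int>\<close>; integrating against a measure turns the exponentials into Fourier
  coefficients, and Lebesgue measure keeps only the zero frequency. Summing the coordinate discrepancies over
  \<open>n \<in> [N, 2N)\<close>, every frequency \<open>\<xi> \<noteq> 0\<close> occurs at most as often as \<open>\<xi>\<close> has divisors, that is
  \<open>O(|\<xi>| powr \<epsilon>)\<close> times, and the quadratic decay of the Fourier transform of \<open>w\<close> together with the
  definition of \<^const>\<open>dim_l1\<close> bounds the sum dyadically. The coordinates decouple because a sum of products
  of nonnegative terms is at most the product of the sums.\<close>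

section \<open>Divisor sums and dyadic weights\<close>

text \<open>Decoupling the coordinates forces absolute values inside the sum over \<open>n\<close>:
  the telescoped product difference multiplies one coordinate discrepancy by factors that vary with
  \<open>n\<close>, so cancellation between different \<open>n\<close> is lost, and the divisor
  bound is what makes this affordable. The divisor factor is charged to \<open>d\<close>, not to
  \<open>N\<close>: quadratic decay concentrates the sum on frequencies of size about 1/d, where
  |\<xi>|^\<epsilon> costs d^(-\<epsilon>). One part of \<epsilon> pays for this, another for a
  supremum in \<open>dim_l1\<close> that need not be attained. The product difference also contains
  Lebesgue factors of size N d_j. They fit under N d_j^(\<kappa>_j - \<epsilon>) because \<kappa>_j
  \<le> 1 and d_j \<le> 1. The measures may be singular, so the Fourier expansion must hold at every
  point of the unit interval, with partial sums bounded uniformly there; dominated convergence then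
  applies to any such measure. This is why Poisson summation is proved with an error bound beside
  the limit.\<close>

lemma card_divisors_prime_power_mult_le:
  fixes p m a :: nat
  assumes p: "prime p" and m: "m > 0"
  shows "card {e. e dvd p ^ a * m} \<le> (a + 1) * card {e. e dvd m}"
proof -
  have "{e. e dvd p ^ a * m} \<subseteq> (\<lambda>(i, e). p ^ i * e) ` ({..a} \<times> {e. e dvd m})"
  proof
    fix e assume "e \<in> {e. e dvd p ^ a * m}"
    then obtain b c where bc: "e = b * c" "b dvd p ^ a" "c dvd m"
      using division_decomp by blast
    then obtain i where "i \<le> a" "b = p ^ i"
      using divides_primepow_nat[OF p] by blast
    then show "e \<in> (\<lambda>(i, e). p ^ i * e) ` ({..a} \<times> {e. e dvd m})"
      using bc by force
  qed
  then have "card {e. e dvd p ^ a * m} \<le> card ({..a} \<times> {e. e dvd m})"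
    using m by (intro surj_card_le) (auto intro: finite_divisors_nat)
  then show ?thesis by (simp add: card_cartesian_product)
qed

text \<open>The divisor count over n^\<epsilon> is a product of factors (a + 1) / p^(a \<epsilon>)
  over the prime powers in n. A prime p \<ge> 2^(1/\<epsilon>) contributes at most 1; each smaller
  prime contributes at most \<open>K\<close>, independent of \<open>a\<close>, and there are at most
  \<open>P\<close> of those.\<close>

lemma divisor_bound:
  fixes \<epsilon> :: real
  assumes \<epsilon>: "\<epsilon> > 0"
  obtains C where "C > 0" "\<And>n::nat. n > 0 \<Longrightarrow> real (card {e. e dvd n}) \<le> C * real n powr \<epsilon>"
proof -
  \<comment> \<open>With c = \<epsilon> ln 2, the product (1 + 1/c)(1 + c a) exceeds a + 1, and 1 +
    c a \<le> exp(c a) = 2^(a \<epsilon>).\<close>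
  define K where "K = 1 + 1 / (\<epsilon> * ln 2)"
  define P where "P = nat \<lceil>2 powr (1 / \<epsilon>)\<rceil>"
  define S where "S n = {p. prime p \<and> p dvd n \<and> p < P}" for n :: nat
  have K1: "K \<ge> 1" using \<epsilon> by (simp add: K_def)
  have finS: "finite (S n)" for n
    by (rule finite_subset[of _ "{..<P}"]) (auto simp: S_def)
  have small: "real a + 1 \<le> K * (real p ^ a) powr \<epsilon>" if p: "prime p" for p a :: nat
  proof -
    have "1 + \<epsilon> * ln 2 * real a \<le> exp (\<epsilon> * ln 2 * real a)"
      by (rule exp_ge_add_one_self)
    also have "\<dots> = (2 ^ a) powr \<epsilon>"
      by (simp add: powr_def ln_realpow mult_ac)
    also have "\<dots> \<le> (real p ^ a) powr \<epsilon>"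
      using prime_ge_2_nat[OF p] \<epsilon> by (intro powr_mono2 power_mono) auto
    finally have "K * (1 + \<epsilon> * ln 2 * real a) \<le> K * (real p ^ a) powr \<epsilon>"
      using K1 by (intro mult_left_mono) auto
    moreover have "K * (1 + \<epsilon> * ln 2 * real a) = real a + 1 + \<epsilon> * ln 2 * real a + 1 / (\<epsilon> * ln 2)"
      using \<epsilon> by (simp add: K_def field_simps)
    moreover have "0 \<le> \<epsilon> * ln 2 * real a + 1 / (\<epsilon> * ln 2)"
      using \<epsilon> by (intro add_nonneg_nonneg) auto
    ultimately show ?thesis by linarith
  qed
  have large: "real a + 1 \<le> (real p ^ a) powr \<epsilon>" if p: "P \<le> p" for p a :: nat
  proof -
    have "2 powr (1 / \<epsilon>) \<le> real P" unfolding P_def by linarith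
    then have *: "2 powr (1 / \<epsilon>) \<le> real p" using p by linarith
    have "real a + 1 \<le> 2 ^ a"
      using Bernoulli_inequality[of "1::real" a] by (simp add: add.commute)
    also have "\<dots> = ((2 powr (1 / \<epsilon>)) ^ a) powr \<epsilon>"
      using \<epsilon> by (simp add: powr_powr powr_realpow[symmetric] mult_ac)
    also have "\<dots> \<le> (real p ^ a) powr \<epsilon>"
      using * \<epsilon> by (intro powr_mono2 power_mono) auto
    finally show ?thesis .
  qed
  \<comment> \<open>The induction strips the full power of one prime. The exponent
    \<open>card (S n)\<close> counts the factors \<open>K\<close> spent: a new one is charged only
    when the stripped prime lies below \<open>P\<close>.\<close>
  have main: "real (card {e. e dvd n}) \<le> K ^ card (S n) * real n powr \<epsilon>" if "n > 0" for n
    using that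
  proof (induction n rule: less_induct)
    case (less n)
    show ?case
    proof (cases "n = 1")
      case True
      then show ?thesis using K1 by (simp add: S_def)
    next
      case False
      then obtain p where p: "prime p" "p dvd n" using prime_factor_nat by blast
      define a where "a = multiplicity p n"
      obtain m where m: "n = p ^ a * m" "\<not> p dvd m"
        using multiplicity_decompose'[of n p] less.prems p a_def by (metis not_prime_unit not_gr_zero)
      have a: "a > 0"
        using p less.prems unfolding a_def by (simp add: prime_multiplicity_gt_zero_iff)
      have m0: "m > 0" using m less.prems by (cases m) auto
      have pa: "p ^ a > 1" using prime_gt_1_nat[OF p(1)] a by (rule one_less_power)
      have "m < n" using m m0 pa by simp
      then have IH: "real (card {e. e dvd m}) \<le> K ^ card (S m) * real m powr \<epsilon>"
        using less.IH m0 by blast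
      define c where "c = (if p < P then K else 1)"
      have c: "real a + 1 \<le> c * (real p ^ a) powr \<epsilon>"
        using small[OF p(1)] large[of p] by (auto simp: c_def)
      have Kc: "K ^ card (S m) * c \<le> K ^ card (S n)"
      proof (cases "p < P")
        case True
        have "insert p (S m) \<subseteq> S n" using p True m by (auto simp: S_def)
        moreover have "p \<notin> S m" using m by (simp add: S_def)
        ultimately have "Suc (card (S m)) \<le> card (S n)"
          using card_mono[OF finS[of n]] finS[of m] by (metis card_insert_disjoint)
        then have "K ^ Suc (card (S m)) \<le> K ^ card (S n)"
          using K1 by (intro power_increasing)
        then show ?thesis using True by (simp add: c_def mult_ac)
      next
        case False
        have "S m \<subseteq> S n" using m by (auto simp: S_def)
        then have "K ^ card (S m) \<le> K ^ card (S n)"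
          using K1 finS by (intro power_increasing card_mono)
        then show ?thesis using False by (simp add: c_def)
      qed
      have "real (card {e. e dvd n}) \<le> (real a + 1) * real (card {e. e dvd m})"
        using of_nat_mono[OF card_divisors_prime_power_mult_le[OF p(1) m0, of a], where 'a = real]
        unfolding m(1) by (simp only: of_nat_mult of_nat_add of_nat_1)
      also have "\<dots> \<le> (c * (real p ^ a) powr \<epsilon>) * (K ^ card (S m) * real m powr \<epsilon>)"
        using c IH by (intro mult_mono) auto
      also have "\<dots> = (K ^ card (S m) * c) * real n powr \<epsilon>"
        unfolding m(1) by (simp add: powr_mult)
      also have "\<dots> \<le> K ^ card (S n) * real n powr \<epsilon>"
        using Kc by (intro mult_right_mono) auto
      finally show ?thesis .
    qed
  qed
  show ?thesis
  proof (rule that[of "K ^ P"])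
    show "K ^ P > 0" using K1 by simp
    fix n :: nat assume n: "n > 0"
    have "card (S n) \<le> card {..<P}" by (rule card_mono) (auto simp: S_def)
    then have "K ^ card (S n) \<le> K ^ P" using K1 by (intro power_increasing) auto
    then have "K ^ card (S n) * real n powr \<epsilon> \<le> K ^ P * real n powr \<epsilon>"
      by (intro mult_right_mono) auto
    then show "real (card {e. e dvd n}) \<le> K ^ P * real n powr \<epsilon>"
      using main[OF n] by linarith
  qed
qed

text \<open>Group the pairs (n, m) by their product \<xi>. As n > 0, it determines m within a group,
  and it divides |\<xi>|, so the group injects into the divisors of |\<xi>|.\<close>

lemma sum_multiples_le_divisor_sum:
  fixes h :: "int \<Rightarrow> real" and A :: "nat set" and K X :: nat
  assumes h: "\<And>\<xi>. 0 \<le> h \<xi>" and A: "finite A" "\<And>n. n \<in> A \<Longrightarrow> 0 < n \<and> n * K \<le> X"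
  shows "(\<Sum>n\<in>A. \<Sum>m | m \<noteq> 0 \<and> \<bar>m\<bar> \<le> int K. h (m * int n))
      \<le> (\<Sum>\<xi> | \<xi> \<noteq> 0 \<and> \<bar>\<xi>\<bar> \<le> int X. real (card {e. e dvd nat \<bar>\<xi>\<bar>}) * h \<xi>)"
proof -
  define M where "M = {m::int. m \<noteq> 0 \<and> \<bar>m\<bar> \<le> int K}"
  define T where "T = {\<xi>::int. \<xi> \<noteq> 0 \<and> \<bar>\<xi>\<bar> \<le> int X}"
  define g where "g = (\<lambda>(n::nat, m::int). m * int n)"
  have fin: "finite M" "finite T"
    unfolding M_def T_def by (rule finite_subset[of _ "{-int K..int K}"], force, simp,
        rule finite_subset[of _ "{-int X..int X}"], force, simp)
  have sub: "g ` (A \<times> M) \<subseteq> T"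
  proof clarify
    fix n m assume nm: "n \<in> A" "m \<in> M"
    have "\<bar>m\<bar> * int n \<le> int K * int n"
      using nm by (intro mult_right_mono) (auto simp: M_def)
    also have "\<dots> \<le> int X"
      using A(2)[OF nm(1)] by (metis mult.commute of_nat_le_iff of_nat_mult)
    finally show "g (n, m) \<in> T"
      using nm A(2)[OF nm(1)] by (auto simp: g_def T_def M_def abs_mult)
  qed
  have "(\<Sum>n\<in>A. \<Sum>m\<in>M. h (m * int n)) = (\<Sum>x\<in>A \<times> M. h (g x))"
    by (simp add: sum.cartesian_product g_def split_def)
  also have "\<dots> = (\<Sum>\<xi>\<in>T. \<Sum>x | x \<in> A \<times> M \<and> g x = \<xi>. h (g x))"
    using sub fin A(1) by (intro sum.group[symmetric]) auto
  also have "\<dots> = (\<Sum>\<xi>\<in>T. real (card {x \<in> A \<times> M. g x = \<xi>}) * h \<xi>)"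
    by (intro sum.cong) auto
  also have "\<dots> \<le> (\<Sum>\<xi>\<in>T. real (card {e. e dvd nat \<bar>\<xi>\<bar>}) * h \<xi>)"
  proof (intro sum_mono mult_right_mono h)
    fix \<xi> assume \<xi>: "\<xi> \<in> T"
    have "inj_on fst {x \<in> A \<times> M. g x = \<xi>}"
    proof (rule inj_onI)
      fix x y assume xy: "x \<in> {x \<in> A \<times> M. g x = \<xi>}" "y \<in> {x \<in> A \<times> M. g x = \<xi>}" "fst x = fst y"
      have "fst x > 0" using xy A(2) by auto
      then show "x = y" using xy by (auto simp: g_def split_def prod_eq_iff)
    qed
    moreover have "fst ` {x \<in> A \<times> M. g x = \<xi>} \<subseteq> {e. e dvd nat \<bar>\<xi>\<bar>}"
      by (auto simp: g_def abs_mult nat_mult_distrib)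
    moreover have "finite {e. e dvd nat \<bar>\<xi>\<bar>}"
      using \<xi> by (intro finite_divisors_nat) (auto simp: T_def)
    ultimately show "real (card {x \<in> A \<times> M. g x = \<xi>}) \<le> real (card {e. e dvd nat \<bar>\<xi>\<bar>})"
      by (intro of_nat_mono card_inj_on_le)
  qed
  finally show ?thesis by (simp add: M_def T_def)
qed

text \<open>\<open>dim_l1\<close> controls only sums over initial segments |\<xi>| \<le> Q, so the
  weight is majorised by indicators of the segments u \<le> 2^i/d. The term with the least such i
  suffices: either i = 0, or u d > 2^(i-1), whose square explains the factor 4 (1/4)^i.\<close>

lemma dyadic_weight_bound:
  fixes u d \<epsilon> :: real and I :: nat
  assumes u: "0 < u" "u \<le> 2 ^ I" and d: "0 < d" "d \<le> 1" and \<epsilon>: "0 \<le> \<epsilon>"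
  shows "u powr \<epsilon> * min 1 (1 / (u * d)\<^sup>2)
      \<le> (\<Sum>i\<le>I. 4 * (1/4) ^ i * (2 ^ i / d) powr \<epsilon> * of_bool (u \<le> 2 ^ i / d))"
proof -
  have uI: "u \<le> 2 ^ I / d"
  proof -
    have "(2::real) ^ I * d \<le> 2 ^ I" using d by simp
    then have "(2::real) ^ I \<le> 2 ^ I / d" using d by (simp add: field_simps)
    then show ?thesis using u by linarith
  qed
  define i where "i = (LEAST i. u \<le> 2 ^ i / d)"
  have i: "u \<le> 2 ^ i / d" unfolding i_def by (rule LeastI) (rule uI)
  have iI: "i \<le> I" unfolding i_def by (rule Least_le) (rule uI)
  have "min 1 (1 / (u * d)\<^sup>2) \<le> 4 * (1/4) ^ i"
  proof (cases i)
    case 0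
    then show ?thesis by simp
  next
    case (Suc j)
    then have "\<not> u \<le> 2 ^ j / d" unfolding i_def using not_less_Least[of j] by force
    then have "2 ^ j < u * d" using d by (simp add: field_simps)
    then have "(2 ^ j)\<^sup>2 \<le> (u * d)\<^sup>2" by (intro power_mono) auto
    then have "(4::real) ^ j \<le> (u * d)\<^sup>2" by (simp add: power_even_eq[symmetric] power_mult)
    then have "1 / (u * d)\<^sup>2 \<le> 1 / 4 ^ j" by (intro divide_left_mono) (use u d in auto)
    then show ?thesis using Suc by (simp add: power_one_over)
  qed
  then have "u powr \<epsilon> * min 1 (1 / (u * d)\<^sup>2) \<le> (2 ^ i / d) powr \<epsilon> * (4 * (1/4) ^ i)"
    using u i \<epsilon> by (intro mult_mono powr_mono2) auto
  also have "\<dots> = 4 * (1/4) ^ i * (2 ^ i / d) powr \<epsilon> * of_bool (u \<le> 2 ^ i / d)"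
    using i by simp
  also have "\<dots> \<le> (\<Sum>i\<le>I. 4 * (1/4) ^ i * (2 ^ i / d) powr \<epsilon> * of_bool (u \<le> 2 ^ i / d))"
    using iI by (intro member_le_sum) auto
  finally show ?thesis .
qed

text \<open>The i-th segment has mass at most C (2^i/d)^(1-s). Since s \<ge> 0 and \<epsilon> \<le>
  1/2, the total exponent of 2^i is at most 3/2, which (1/4)^i beats: the geometric ratio is
  2^(-1/2), whose sum gives the constant.\<close>

lemma weighted_sum_bound:
  fixes b :: "int \<Rightarrow> real" and s \<epsilon> C d :: real and X :: nat
  assumes b: "\<And>\<xi>. 0 \<le> b \<xi>" and s: "0 \<le> s" and \<epsilon>: "0 \<le> \<epsilon>" "\<epsilon> \<le> 1/2" and d: "0 < d" "d \<le> 1"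
    and B: "\<And>Q::real. Q \<ge> 1 \<Longrightarrow> (\<Sum>\<xi> | \<bar>real_of_int \<xi>\<bar> \<le> Q. b \<xi>) \<le> C * Q powr (1 - s)"
  shows "(\<Sum>\<xi> | \<xi> \<noteq> 0 \<and> \<bar>\<xi>\<bar> \<le> int X.
            \<bar>real_of_int \<xi>\<bar> powr \<epsilon> * min 1 (1 / (\<bar>real_of_int \<xi>\<bar> * d)\<^sup>2) * b \<xi>)
      \<le> 4 / (1 - 2 powr (-1/2)) * C * d powr (s - 1 - \<epsilon>)"
proof -
  define T where "T = {\<xi>::int. \<xi> \<noteq> 0 \<and> \<bar>\<xi>\<bar> \<le> int X}"
  have finT: "finite T"
    unfolding T_def by (rule finite_subset[of _ "{-int X..int X}"]) force+
  have finQ: "finite {\<xi>. \<bar>real_of_int \<xi>\<bar> \<le> Q}" for Q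
    by (rule finite_subset[of _ "{-\<lceil>Q\<rceil>..\<lceil>Q\<rceil>}"]) (auto, linarith+)
  have C0: "0 \<le> C"
    using B[of 1] sum_nonneg[of "{\<xi>. \<bar>real_of_int \<xi>\<bar> \<le> 1}" b] b by simp
  define r :: real where "r = 2 powr (-1/2)"
  have r: "0 < r" "r < 1" by (auto simp: r_def powr_less_one)
  have "(\<Sum>\<xi>\<in>T. \<bar>real_of_int \<xi>\<bar> powr \<epsilon> * min 1 (1 / (\<bar>real_of_int \<xi>\<bar> * d)\<^sup>2) * b \<xi>)
      \<le> (\<Sum>\<xi>\<in>T. (\<Sum>i\<le>X. 4 * (1/4) ^ i * (2 ^ i / d) powr \<epsilon>
              * of_bool (\<bar>real_of_int \<xi>\<bar> \<le> 2 ^ i / d)) * b \<xi>)"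
  proof (intro sum_mono mult_right_mono b dyadic_weight_bound d \<epsilon>)
    fix \<xi> assume \<xi>: "\<xi> \<in> T"
    then show "0 < \<bar>real_of_int \<xi>\<bar>" by (simp add: T_def)
    have "\<bar>real_of_int \<xi>\<bar> \<le> real X" using \<xi> by (simp add: T_def flip: of_int_abs)
    also have "\<dots> \<le> 2 ^ X" by (simp add: less_imp_le of_nat_less_two_power)
    finally show "\<bar>real_of_int \<xi>\<bar> \<le> 2 ^ X" .
  qed
  also have "\<dots> = (\<Sum>i\<le>X. 4 * (1/4) ^ i * (2 ^ i / d) powr \<epsilon>
              * (\<Sum>\<xi>\<in>T. of_bool (\<bar>real_of_int \<xi>\<bar> \<le> 2 ^ i / d) * b \<xi>))"
    unfolding sum_distrib_right sum_distrib_left by (subst sum.swap) (simp add: mult_ac)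
  also have "\<dots> \<le> (\<Sum>i\<le>X. 4 * C * d powr (s - 1 - \<epsilon>) * r ^ i)"
  proof (rule sum_mono)
    fix i
    have Q1: "2 ^ i / d \<ge> 1"
      using order_trans[OF d(2) one_le_power[of "2::real" i]] d(1) by (simp add: field_simps)
    have "(\<Sum>\<xi>\<in>T. of_bool (\<bar>real_of_int \<xi>\<bar> \<le> 2 ^ i / d) * b \<xi>)
        = sum b {\<xi>\<in>T. \<bar>real_of_int \<xi>\<bar> \<le> 2 ^ i / d}"
      using finT by (auto simp: sum.inter_filter of_bool_def intro!: sum.cong)
    also have "\<dots> \<le> (\<Sum>\<xi> | \<bar>real_of_int \<xi>\<bar> \<le> 2 ^ i / d. b \<xi>)"
      using finQ b by (intro sum_mono2) auto
    also have "\<dots> \<le> C * (2 ^ i / d) powr (1 - s)"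
      by (rule B[OF Q1])
    finally have "4 * (1/4) ^ i * (2 ^ i / d) powr \<epsilon>
              * (\<Sum>\<xi>\<in>T. of_bool (\<bar>real_of_int \<xi>\<bar> \<le> 2 ^ i / d) * b \<xi>)
        \<le> 4 * (1/4) ^ i * (2 ^ i / d) powr \<epsilon> * (C * (2 ^ i / d) powr (1 - s))"
      by (intro mult_left_mono) auto
    also have "\<dots> = 4 * C * ((1/4) ^ i * (2 ^ i / d) powr (1 - s + \<epsilon>))"
      by (simp add: powr_add mult_ac)
    also have "(2 ^ i / d) powr (1 - s + \<epsilon>) = d powr (s - 1 - \<epsilon>) * (2 ^ i) powr (1 - s + \<epsilon>)"
      using d by (simp add: powr_divide powr_minus_divide[symmetric] algebra_simps)
         (simp add: powr_minus_divide powr_diff powr_add field_simps)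
    also have "4 * C * ((1/4) ^ i * (d powr (s - 1 - \<epsilon>) * (2 ^ i) powr (1 - s + \<epsilon>)))
        \<le> 4 * C * ((1/4) ^ i * (d powr (s - 1 - \<epsilon>) * (2 ^ i) powr (3 / 2)))"
      using C0 s \<epsilon> by (intro mult_left_mono powr_mono) auto
    also have "(1/4) ^ i * (d powr (s - 1 - \<epsilon>) * (2 ^ i) powr (3 / 2)) = d powr (s - 1 - \<epsilon>) * r ^ i"
    proof -
      have "(1/4 :: real) ^ i = 2 powr (- 2 * real i)"
        by (simp add: powr_minus_divide powr_realpow[symmetric] powr_powr power_one_over)
           (simp add: powr_powr[symmetric])
      moreover have "(2 ^ i) powr (3 / 2) = (2::real) powr (3/2 * real i)"
        by (simp add: powr_realpow[symmetric] powr_powr mult_ac)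
      moreover have "r ^ i = 2 powr (- 1/2 * real i)"
        by (simp add: r_def powr_realpow[symmetric] powr_powr)
      ultimately show ?thesis
        by (simp add: powr_add[symmetric] algebra_simps)
    qed
    finally show "4 * (1/4) ^ i * (2 ^ i / d) powr \<epsilon>
              * (\<Sum>\<xi>\<in>T. of_bool (\<bar>real_of_int \<xi>\<bar> \<le> 2 ^ i / d) * b \<xi>)
        \<le> 4 * C * d powr (s - 1 - \<epsilon>) * r ^ i" by (simp add: mult_ac)
  qed
  also have "\<dots> = 4 * C * d powr (s - 1 - \<epsilon>) * (\<Sum>i\<le>X. r ^ i)"
    by (simp add: sum_distrib_left)
  also have "\<dots> \<le> 4 * C * d powr (s - 1 - \<epsilon>) * (1 / (1 - r))"
  proof (intro mult_left_mono)
    have "(\<Sum>i\<le>X. r ^ i) \<le> suminf (\<lambda>i. r ^ i)"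
      using r by (intro sum_le_suminf summable_geometric) auto
    then show "(\<Sum>i\<le>X. r ^ i) \<le> 1 / (1 - r)"
      using r by (simp add: suminf_geometric)
  qed (use C0 in auto)
  finally show ?thesis by (simp add: T_def r_def mult_ac)
qed

text \<open>Peel off one factor at a time: I I' - L L' = (I - L) L' + I (I' - L'). A single
  discrepancy is at most its sum \<open>T j\<close>, so every |I j n| is at most
  \<open>l j + T j\<close>; the two halves then recombine into the factor
  \<open>l k + T k\<close>.\<close>

lemma sum_prod_diff_le:
  fixes I L :: "nat \<Rightarrow> nat \<Rightarrow> real" and l T :: "nat \<Rightarrow> real"
  assumes "finite A"
    and "\<And>j n. j < k \<Longrightarrow> n \<in> A \<Longrightarrow> \<bar>L j n\<bar> \<le> l j"
    and "\<And>j. j < k \<Longrightarrow> 0 \<le> l j"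
    and "\<And>j. j < k \<Longrightarrow> (\<Sum>n\<in>A. \<bar>I j n - L j n\<bar>) \<le> T j"
  shows "(\<Sum>n\<in>A. \<bar>(\<Prod>j<k. I j n) - (\<Prod>j<k. L j n)\<bar>) \<le> (\<Prod>j<k. l j + T j)"
  using assms(2-)
proof (induction k)
  case 0
  then show ?case by simp
next
  case (Suc k)
  have T: "0 \<le> T j" if "j < Suc k" for j
    by (rule order_trans[OF _ Suc.prems(3)[OF that]]) (simp add: sum_nonneg)
  have IB: "\<bar>I j n\<bar> \<le> l j + T j" if "j < Suc k" "n \<in> A" for j n
  proof -
    have "\<bar>I j n - L j n\<bar> \<le> (\<Sum>n\<in>A. \<bar>I j n - L j n\<bar>)"
      using assms(1) that by (intro member_le_sum) auto
    then show ?thesis using Suc.prems(1)[of j n] Suc.prems(3)[of j] that by linarith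
  qed
  have pB: "\<bar>\<Prod>j<k. I j n\<bar> \<le> (\<Prod>j<k. l j + T j)" if "n \<in> A" for n
    unfolding abs_prod using IB that by (intro prod_mono) auto
  have "(\<Sum>n\<in>A. \<bar>(\<Prod>j<Suc k. I j n) - (\<Prod>j<Suc k. L j n)\<bar>)
      \<le> (\<Sum>n\<in>A. \<bar>(\<Prod>j<k. I j n) - (\<Prod>j<k. L j n)\<bar> * l k + (\<Prod>j<k. l j + T j) * \<bar>I k n - L k n\<bar>)"
  proof (rule sum_mono)
    fix n assume n: "n \<in> A"
    have "(\<Prod>j<Suc k. I j n) - (\<Prod>j<Suc k. L j n)
        = ((\<Prod>j<k. I j n) - (\<Prod>j<k. L j n)) * L k n + (\<Prod>j<k. I j n) * (I k n - L k n)"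
      by (simp add: algebra_simps)
    also have "\<bar>\<dots>\<bar> \<le> \<bar>(\<Prod>j<k. I j n) - (\<Prod>j<k. L j n)\<bar> * \<bar>L k n\<bar> + \<bar>\<Prod>j<k. I j n\<bar> * \<bar>I k n - L k n\<bar>"
      by (metis abs_mult abs_triangle_ineq)
    also have "\<dots> \<le> \<bar>(\<Prod>j<k. I j n) - (\<Prod>j<k. L j n)\<bar> * l k + (\<Prod>j<k. l j + T j) * \<bar>I k n - L k n\<bar>"
      using Suc.prems(1)[of k n] n pB[OF n] by (intro add_mono mult_left_mono mult_right_mono) auto
    finally show "\<bar>(\<Prod>j<Suc k. I j n) - (\<Prod>j<Suc k. L j n)\<bar> \<le> \<dots>" .
  qed
  also have "\<dots> = (\<Sum>n\<in>A. \<bar>(\<Prod>j<k. I j n) - (\<Prod>j<k. L j n)\<bar>) * l k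
      + (\<Prod>j<k. l j + T j) * (\<Sum>n\<in>A. \<bar>I k n - L k n\<bar>)"
    by (simp add: sum.distrib sum_distrib_left sum_distrib_right)
  also have "\<dots> \<le> (\<Prod>j<k. l j + T j) * l k + (\<Prod>j<k. l j + T j) * T k"
    using Suc T by (intro add_mono mult_right_mono mult_left_mono prod_nonneg) auto
  finally show ?case by (simp add: algebra_simps)
qed

section \<open>Bessel inequality on the unit interval\<close>

definition unit_char :: "real \<Rightarrow> complex" where
  "unit_char t = cis (2 * pi * t)"

lemma unit_char_0 [simp]: "unit_char 0 = 1"
  by (simp add: unit_char_def)

lemma unit_char_add: "unit_char (s + t) = unit_char s * unit_char t"
  by (simp add: unit_char_def cis_mult distrib_left)

lemma norm_unit_char [simp]: "norm (unit_char t) = 1"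
  by (simp add: unit_char_def)

lemma cnj_unit_char: "cnj (unit_char t) = unit_char (- t)"
  by (simp add: unit_char_def cis_cnj)

lemma unit_char_int [simp]: "unit_char (of_int m) = 1"
  by (simp add: unit_char_def cis_multiple_2pi)

lemma continuous_on_unit_char [continuous_intros]:
  "continuous_on A f \<Longrightarrow> continuous_on A (\<lambda>x. unit_char (f x))"
  unfolding unit_char_def by (intro continuous_intros)

lemma measurable_unit_char [measurable]: "unit_char \<in> borel_measurable borel"
  by (intro borel_measurable_continuous_onI continuous_intros)

lemma has_vector_derivative_unit_char:
  "((\<lambda>t. unit_char (c * t)) has_vector_derivative (2 * pi * c * \<i>) * unit_char (c * t)) (at t within A)"
  unfolding unit_char_def cis_conv_exp
  by (rule derivative_eq_intros has_vector_derivative_real_field refl | simp)+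

text \<open>Serves as the denominator of a difference quotient: on the unit interval |e(t) - 1| = 2
  sin(pi t) vanishes only at the endpoints, and there linearly.\<close>

lemma norm_unit_char_minus_1_ge:
  assumes "0 \<le> t" "t \<le> 1"
  shows "min t (1 - t) \<le> norm (unit_char t - 1)"
proof -
  \<comment> \<open>On [0, 2] the cubic Taylor error x^3/6 is at most 2x/3, so sin x \<ge> x/3; with
    x = pi s \<ge> 2 s this leaves 4 s/3 to spare against s.\<close>
  have sin_ge: "s \<le> 2 * sin (pi * s)" if s: "0 \<le> s" "s \<le> 1/2" for s
  proof -
    define x where "x = pi * s"
    have x: "0 \<le> x" "x \<le> 2"
      using s pi_less_4 mult_mono[of pi 4 s "1/2"] by (auto simp: x_def)
    have "\<bar>sin x - x\<bar> \<le> x ^ 3 / 6"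
      using Maclaurin_sin_bound[of x 3] x
      by (simp add: eval_nat_numeral sin_coeff_def lessThan_Suc)
    moreover have "x ^ 3 \<le> 4 * x"
    proof -
      have "x * x \<le> 2 * 2" using x by (intro mult_mono) auto
      then have "x * x * x \<le> 4 * x" using x by (intro mult_right_mono) auto
      then show ?thesis by (simp add: power3_eq_cube)
    qed
    ultimately have "sin x \<ge> x / 3" by linarith
    moreover have "x \<ge> 2 * s" using pi_ge_two s by (simp add: x_def mult_right_mono)
    ultimately show ?thesis using s by (simp add: x_def)
  qed
  have eq: "norm (unit_char t - 1) = 2 * sin (pi * t)"
    using dist_exp_i_1[of "2 * pi * t"] sin_ge_zero[of "pi * t"] assms
    by (simp add: unit_char_def cis_conv_exp mult_left_le)
  show ?thesis
  proof (cases "t \<le> 1/2")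
    case True
    then show ?thesis using sin_ge[of t] assms eq by simp
  next
    case False
    have "sin (pi * (1 - t)) = sin (pi * t)"
      by (metis right_diff_distrib mult.right_neutral sin_pi_minus)
    then show ?thesis using sin_ge[of "1 - t"] False assms eq by simp
  qed
qed

section \<open>Fourier coefficients, orthogonality and Bessel on the unit interval\<close>

lemma fourier_coeff_eq: "fourier_coeff \<nu> m = (LINT x|\<nu>. unit_char (- (of_int m * x)))"
  by (simp add: fourier_coeff_def unit_char_def mult_ac)

lemma space_leb01 [simp]: "space leb01 = {0..1}"
  by (simp add: leb01_def space_restrict_space)

lemma borel_measurable_leb01: "f \<in> borel_measurable borel \<Longrightarrow> f \<in> borel_measurable leb01"
  unfolding leb01_def by (rule measurable_restrict_space1) simp

lemma leb01_id_measurable: "(\<lambda>x. x) \<in> borel_measurable leb01"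
  by (rule borel_measurable_leb01) simp

lemma prob_space_leb01: "prob_space leb01"
  by (rule prob_spaceI) (simp add: leb01_def space_restrict_space emeasure_restrict_space)

lemma integral_leb01:
  fixes f :: "real \<Rightarrow> 'a::{banach, second_countable_topology}"
  shows "integral\<^sup>L leb01 f = (LINT x|lborel. indicator {0..1} x *\<^sub>R f x)"
  unfolding leb01_def by (rule integral_restrict_space) simp

lemma fourier_coeff_leb01: "fourier_coeff leb01 m = of_bool (m = 0)"
proof (cases "m = 0")
  case True
  interpret prob_space leb01 by (rule prob_space_leb01)
  show ?thesis using True prob_space by (simp add: fourier_coeff_eq)
next
  case False
  define c where "c = - (2 * pi * real_of_int m * \<i>)"
  have c: "c \<noteq> 0" using False by (simp add: c_def)
  have "fourier_coeff leb01 m = (LINT x|lborel. indicator {0..1} x *\<^sub>R unit_char (- of_int m * x))"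
    by (simp add: fourier_coeff_eq integral_leb01)
  also have "\<dots> = unit_char (- of_int m * 1) / c - unit_char (- of_int m * 0) / c"
  proof (rule integral_FTC_Icc)
    fix x :: real
    have "((\<lambda>x. unit_char (- of_int m * x) / c) has_vector_derivative
        (2 * pi * (- of_int m) * \<i>) * unit_char (- of_int m * x) / c) (at x within {0..1})"
      using has_vector_derivative_unit_char[of "- of_int m" x "{0..1}"]
      by (auto intro!: derivative_eq_intros)
    then show "((\<lambda>x. unit_char (- of_int m * x) / c) has_vector_derivative
        unit_char (- of_int m * x)) (at x within {0..1})"
      using c by (simp add: c_def)
  qed (auto intro!: continuous_intros)
  also have "\<dots> = 0"
    using unit_char_int[of "- m"] by simp
  finally show ?thesis using False by simp
qed

lemma leb01_integrable_bounded:
  fixes f :: "real \<Rightarrow> complex"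
  assumes "f \<in> borel_measurable borel" "\<And>t. t \<in> {0..1} \<Longrightarrow> norm (f t) \<le> B"
  shows "integrable leb01 f"
proof -
  interpret prob_space leb01 by (rule prob_space_leb01)
  show ?thesis
    by (rule integrable_const_bound[of _ B]) (use assms in \<open>auto intro!: AE_I2 borel_measurable_leb01\<close>)
qed

text \<open>With \<open>p\<close> the partial Fourier sum of \<open>q\<close> over \<open>S\<close>,
  the pairings of \<open>q\<close> and of \<open>p\<close> with \<open>p\<close> both equal the sum
  of |c_m|^2. Integrating 2 Re(q cnj p) - |p|^2 \<le> |q|^2 \<le> B^2 therefore gives the
  claim.\<close>

lemma bessel_inequality:
  fixes q :: "real \<Rightarrow> complex"
  assumes q [measurable]: "q \<in> borel_measurable borel"
    and B: "\<And>t. t \<in> {0..1} \<Longrightarrow> norm (q t) \<le> B"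
    and S: "finite S"
  defines "c \<equiv> \<lambda>m::int. (LINT t|leb01. q t * unit_char (- (of_int m * t)))"
  shows "(\<Sum>m\<in>S. (norm (c m))\<^sup>2) \<le> B\<^sup>2"
proof -
  interpret prob_space leb01 by (rule prob_space_leb01)
  define p where "p t = (\<Sum>m\<in>S. c m * unit_char (of_int m * t))" for t
  define P where "P = (\<Sum>m\<in>S. norm (c m))"
  have p_meas [measurable]: "p \<in> borel_measurable borel" unfolding p_def by measurable
  have P: "norm (p t) \<le> P" for t
    unfolding p_def P_def by (rule sum_norm_le) (simp add: norm_mult)
  have B0: "0 \<le> B" using B[of 0] norm_ge_zero[of "q 0"] by (simp del: norm_ge_zero)
  have P0: "0 \<le> P" unfolding P_def by (simp add: sum_nonneg)
  have cp: "(LINT t|leb01. p t * unit_char (- (of_int n * t))) = c n" if n: "n \<in> S" for n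
  proof -
    have "(LINT t|leb01. p t * unit_char (- (of_int n * t)))
        = (LINT t|leb01. (\<Sum>m\<in>S. c m * unit_char (- (of_int (n - m) * t))))"
      unfolding p_def sum_distrib_right
      by (intro Bochner_Integration.integral_cong sum.cong refl)
         (simp add: mult.assoc unit_char_add[symmetric] algebra_simps)
    also have "\<dots> = (\<Sum>m\<in>S. LINT t|leb01. c m * unit_char (- (of_int (n - m) * t)))"
      by (intro Bochner_Integration.integral_sum leb01_integrable_bounded[where B = "norm (c _)"])
         (auto simp: norm_mult)
    also have "\<dots> = (\<Sum>m\<in>S. c m * fourier_coeff leb01 (n - m))"
      unfolding fourier_coeff_eq by simp
    also have "\<dots> = (\<Sum>m\<in>S. if n = m then c m else 0)"
      by (intro sum.cong) (auto simp: fourier_coeff_leb01)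
    finally show ?thesis using S n by simp
  qed
  have cnjp: "cnj (p t) = (\<Sum>m\<in>S. cnj (c m) * unit_char (- (of_int m * t)))" for t
    by (simp add: p_def cnj_unit_char)
  have cnjp_meas [measurable]: "(\<lambda>t. cnj (p t)) \<in> borel_measurable borel"
    unfolding cnjp by measurable
  have pair: "(LINT t|leb01. f t * cnj (p t)) = (\<Sum>m\<in>S. cnj (c m) * c m)"
    if f [measurable]: "f \<in> borel_measurable borel" and bd: "\<And>t. t \<in> {0..1} \<Longrightarrow> norm (f t) \<le> D"
      and fc: "\<And>m. m \<in> S \<Longrightarrow> (LINT t|leb01. f t * unit_char (- (of_int m * t))) = c m"
    for f D
  proof -
    have "(LINT t|leb01. f t * cnj (p t))
        = (LINT t|leb01. (\<Sum>m\<in>S. cnj (c m) * (f t * unit_char (- (of_int m * t)))))"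
      unfolding cnjp sum_distrib_left by (simp add: mult_ac)
    also have "\<dots> = (\<Sum>m\<in>S. LINT t|leb01. cnj (c m) * (f t * unit_char (- (of_int m * t))))"
      by (intro Bochner_Integration.integral_sum leb01_integrable_bounded[where B = "norm (c _) * D"])
         (auto simp: norm_mult intro!: mult_left_mono bd)
    also have "\<dots> = (\<Sum>m\<in>S. cnj (c m) * c m)"
      using fc by (intro sum.cong) simp_all
    finally show ?thesis .
  qed
  have qp: "(LINT t|leb01. q t * cnj (p t)) = (\<Sum>m\<in>S. cnj (c m) * c m)"
    by (rule pair[OF q B]) (simp_all add: c_def)
  have pp: "(LINT t|leb01. p t * cnj (p t)) = (\<Sum>m\<in>S. cnj (c m) * c m)"
    by (rule pair[OF p_meas P cp])
  have int_qp: "integrable leb01 (\<lambda>t. q t * cnj (p t))"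
    by (rule leb01_integrable_bounded[where B = "B * P"])
       (auto simp: norm_mult intro!: mult_mono B P B0)
  have int_pp: "integrable leb01 (\<lambda>t. p t * cnj (p t))"
    by (rule leb01_integrable_bounded[where B = "P * P"])
       (auto simp: norm_mult intro!: mult_mono P P0)
  have sq: "cnj (c m) * c m = of_real ((norm (c m))\<^sup>2)" for m
    by (metis complex_norm_square mult.commute)
  have "(\<Sum>m\<in>S. (norm (c m))\<^sup>2) = Re (\<Sum>m\<in>S. cnj (c m) * c m)"
    by (simp add: sq)
  also have "\<dots> = Re (2 * (LINT t|leb01. q t * cnj (p t)) - (LINT t|leb01. p t * cnj (p t)))"
    by (simp add: qp pp)
  also have "\<dots> = Re (LINT t|leb01. 2 * (q t * cnj (p t)) - p t * cnj (p t))"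
    using int_qp int_pp by simp
  also have "\<dots> = (LINT t|leb01. Re (2 * (q t * cnj (p t)) - p t * cnj (p t)))"
    using int_qp int_pp by (intro integral_Re[symmetric]) auto
  also have "\<dots> \<le> (LINT t|leb01. B\<^sup>2)"
  proof (rule integral_mono_AE)
    show "integrable leb01 (\<lambda>t. Re (2 * (q t * cnj (p t)) - p t * cnj (p t)))"
      using int_qp int_pp by (intro integrable_Re) auto
    show "AE t in leb01. Re (2 * (q t * cnj (p t)) - p t * cnj (p t)) \<le> B\<^sup>2"
    proof (rule AE_I2)
      fix t assume t: "t \<in> space leb01"
      \<comment> \<open>Completing the square pointwise.\<close>
      have "(norm (q t))\<^sup>2 - Re (2 * (q t * cnj (p t)) - p t * cnj (p t)) = (norm (q t - p t))\<^sup>2"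
        by (simp add: cmod_power2) (simp add: power2_eq_square algebra_simps)
      moreover have "(norm (q t))\<^sup>2 \<le> B\<^sup>2"
        using t by (intro power_mono B) auto
      ultimately show "Re (2 * (q t * cnj (p t)) - p t * cnj (p t)) \<le> B\<^sup>2"
        using zero_le_power2[of "norm (q t - p t)"] by linarith
    qed
  qed simp
  also have "\<dots> = B\<^sup>2" using prob_space by simp
  finally show ?thesis .
qed

text \<open>Along an injective sequence of frequencies Bessel makes the squared coefficients
  summable, so they tend to zero. Injectivity keeps any frequency from being counted twice.\<close>

lemma riemann_lebesgue_inj:
  fixes q :: "real \<Rightarrow> complex" and g :: "nat \<Rightarrow> int"
  assumes q: "q \<in> borel_measurable borel" and B: "\<And>t. t \<in> {0..1} \<Longrightarrow> norm (q t) \<le> B"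
    and g: "inj g"
  shows "(\<lambda>K. LINT t|leb01. q t * unit_char (- (of_int (g K) * t))) \<longlonglongrightarrow> 0"
proof -
  define c where "c m = (LINT t|leb01. q t * unit_char (- (of_int m * t)))" for m :: int
  have "summable (\<lambda>K. (norm (c (g K)))\<^sup>2)"
  proof (rule summableI_nonneg_bounded)
    fix n
    have "(\<Sum>K<n. (norm (c (g K)))\<^sup>2) = (\<Sum>m\<in>g ` {..<n}. (norm (c m))\<^sup>2)"
      using g by (subst sum.reindex) (auto intro: inj_on_subset)
    also have "\<dots> \<le> B\<^sup>2"
      unfolding c_def by (rule bessel_inequality[OF q B]) auto
    finally show "(\<Sum>K<n. (norm (c (g K)))\<^sup>2) \<le> B\<^sup>2" .
  qed simp
  then have "(\<lambda>K. (norm (c (g K)))\<^sup>2) \<longlonglongrightarrow> 0" by (rule summable_LIMSEQ_zero)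
  then have "(\<lambda>K. sqrt ((norm (c (g K)))\<^sup>2)) \<longlonglongrightarrow> sqrt 0" by (rule tendsto_real_sqrt)
  then show ?thesis by (simp add: tendsto_norm_zero_iff c_def)
qed

section \<open>Poisson summation\<close>

definition fourier_transform :: "(real \<Rightarrow> real) \<Rightarrow> real \<Rightarrow> complex" where
  "fourier_transform f \<xi> = (LINT t|lborel. of_real (f t) * unit_char (- (\<xi> * t)))"

lemma integrable_compact_support_times_unit_char:
  fixes f :: "real \<Rightarrow> real"
  assumes f: "continuous_on UNIV f" and supp: "\<And>x. R < \<bar>x\<bar> \<Longrightarrow> f x = 0"
  shows "integrable lborel (\<lambda>t. of_real (f t) * unit_char (\<xi> * t))"
proof -
  have "integrable lborel (\<lambda>t. indicator {-R..R} t *\<^sub>R (of_real (f t) * unit_char (\<xi> * t)))"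
    by (rule borel_integrable_compact) (auto intro!: continuous_intros continuous_on_subset[OF f])
  also have "(\<lambda>t. indicator {-R..R} t *\<^sub>R (of_real (f t) * unit_char (\<xi> * t)))
      = (\<lambda>t. of_real (f t) * unit_char (\<xi> * t))"
  proof
    fix t
    show "indicator {-R..R} t *\<^sub>R (of_real (f t) * unit_char (\<xi> * t)) = of_real (f t) * unit_char (\<xi> * t)"
      using supp[of t] by (cases "t \<in> {-R..R}") auto
  qed
  finally show ?thesis .
qed

text \<open>Cut the line into unit cells, translate each to the unit interval, and use that integer
  translations leave the integer frequency \<open>m\<close> unchanged.\<close>

lemma fourier_transform_periodize:
  fixes f :: "real \<Rightarrow> real" and R :: nat and m :: int
  assumes f: "continuous_on UNIV f" and supp: "\<And>x. real R < \<bar>x\<bar> \<Longrightarrow> f x = 0"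
  shows "fourier_transform f (of_int m)
      = (LINT t|leb01. of_real (\<Sum>a\<in>{- int R - 1..int R}. f (of_int a + t)) * unit_char (- (of_int m * t)))"
proof -
  define J where "J = {- int R - 1..int R}"
  define h where "h t = of_real (f t) * unit_char (- (of_int m * t))" for t
  have h_int: "integrable lborel h"
    using integrable_compact_support_times_unit_char[OF f supp, where \<xi> = "- of_int m"] by (simp add: h_def[abs_def])
  have h_cont: "continuous_on UNIV h"
    unfolding h_def by (intro continuous_intros f)
  have ind: "(\<Sum>a\<in>J. indicator {of_int a..<of_int a + 1} t *\<^sub>R h t) = h t" for t
  proof (cases "real R < \<bar>t\<bar>")
    case True
    then show ?thesis using supp by (simp add: h_def)
  next
    case False
    have "indicator {real_of_int a..<of_int a + 1} t = (if a = \<lfloor>t\<rfloor> then 1 else 0 :: real)" for a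
      by (auto split: split_indicator; linarith)
    moreover have "\<lfloor>t\<rfloor> \<in> J"
      using False by (auto simp: J_def floor_le_iff le_floor_iff)
    ultimately show ?thesis by (simp add: if_distrib[of "\<lambda>c. c *\<^sub>R h t"] J_def cong: if_cong)
  qed
  have "fourier_transform f (of_int m) = (LINT t|lborel. (\<Sum>a\<in>J. indicator {of_int a..<of_int a + 1} t *\<^sub>R h t))"
    unfolding ind by (simp add: fourier_transform_def h_def)
  also have "\<dots> = (\<Sum>a\<in>J. LINT t|lborel. indicator {of_int a..<of_int a + 1} t *\<^sub>R h t)"
    using h_int by (intro Bochner_Integration.integral_sum integrable_mult_indicator) auto
  also have "\<dots> = (\<Sum>a\<in>J. LINT t|leb01. h (of_int a + t))"
  proof (intro sum.cong refl)
    fix a :: int assume "a \<in> J"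
    have "(LINT t|lborel. indicator {of_int a..<of_int a + 1} t *\<^sub>R h t)
        = (LINT t|lborel. indicator {of_int a..<of_int a + 1} (of_int a + t) *\<^sub>R h (of_int a + t))"
      by (subst lborel_integral_real_affine[of 1 _ "of_int a"]) auto
    also have "\<dots> = (LINT t|lborel. indicator {0..1} t *\<^sub>R h (of_int a + t))"
    \<comment> \<open>Half-open cells partition the line, while \<open>leb01\<close> lives on the
      closed interval; the integrands differ only at t = 1.\<close>
    proof (rule integral_cong_AE)
      show "AE t in lborel. indicator {of_int a..<of_int a + 1} (of_int a + t) *\<^sub>R h (of_int a + t)
          = indicator {0..1} t *\<^sub>R h (of_int a + t)"
        using AE_lborel_singleton[of 1]
        by eventually_elim (auto split: split_indicator)
      have [measurable]: "h \<in> borel_measurable borel"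
        by (rule borel_measurable_continuous_onI[OF h_cont])
      show "(\<lambda>t. indicator {of_int a..<of_int a + 1} (of_int a + t) *\<^sub>R h (of_int a + t)) \<in> borel_measurable lborel"
        "(\<lambda>t. indicator {0..1} t *\<^sub>R h (of_int a + t)) \<in> borel_measurable lborel"
        by measurable
    qed
    finally show "(LINT t|lborel. indicator {of_int a..<of_int a + 1} t *\<^sub>R h t) = (LINT t|leb01. h (of_int a + t))"
      by (simp add: integral_leb01)
  qed
  also have "\<dots> = (LINT t|leb01. (\<Sum>a\<in>J. h (of_int a + t)))"
  proof (rule Bochner_Integration.integral_sum[symmetric])
    fix a
    have "continuous_on {0..1} (\<lambda>t. h (of_int a + t))"
      by (rule continuous_on_compose2[OF h_cont]) (auto intro!: continuous_intros)
    then show "integrable leb01 (\<lambda>t. h (of_int a + t))"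
      unfolding leb01_def by (subst integrable_restrict_space) (auto intro!: borel_integrable_compact)
  qed
  also have "\<dots> = (LINT t|leb01. of_real (\<Sum>a\<in>J. f (of_int a + t)) * unit_char (- (of_int m * t)))"
  proof (intro Bochner_Integration.integral_cong refl)
    fix t
    have "unit_char (- (of_int m * (of_int a + t))) = unit_char (- (of_int m * t))" for a
      using unit_char_add[of "of_int (- (m * a))" "- (of_int m * t)"]
      unfolding unit_char_int by (simp add: algebra_simps)
    then show "(\<Sum>a\<in>J. h (of_int a + t)) = of_real (\<Sum>a\<in>J. f (of_int a + t)) * unit_char (- (of_int m * t))"
      by (simp add: h_def sum_distrib_right)
  qed
  finally show ?thesis by (simp add: J_def)
qed

lemma sum_int_telescope_symmetric:
  fixes c :: "int \<Rightarrow> 'a::ab_group_add"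
  shows "(\<Sum>m\<in>{- int K..int K}. c (m - 1) - c m) = c (- int K - 1) - c (int K)"
proof (induction K)
  case (Suc K)
  have eqs: "- int (Suc K) - 1 = - int K - 1 - 1" "int (Suc K) = int K + 1" by auto
  have "{- int (Suc K)..int (Suc K)} = insert (- int K - 1) (insert (int K + 1) {- int K..int K})"
    by auto
  then have "(\<Sum>m\<in>{- int (Suc K)..int (Suc K)}. c (m - 1) - c m)
      = (c (- int K - 1 - 1) - c (- int K - 1)) + ((c (int K) - c (int K + 1)) + (\<Sum>m\<in>{- int K..int K}. c (m - 1) - c m))"
    by simp
  also have "\<dots> = c (- int (Suc K) - 1) - c (int (Suc K))"
    unfolding Suc eqs by simp
  finally show ?case .
qed simp

text \<open>The difference quotient \<open>q t = (G t - G 0) / (unit_char t - 1)\<close> of the periodization \<open>G\<close>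
  is bounded, and the Fourier coefficients of \<open>G - G 0 = q * (unit_char - 1)\<close> telescope;
  so the error of the partial sums is a difference of two Fourier coefficients of \<open>q\<close>.\<close>

lemma poisson_summation:
  fixes f :: "real \<Rightarrow> real" and R :: nat and L :: real
  assumes lip: "\<And>x y. \<bar>f x - f y\<bar> \<le> L * \<bar>x - y\<bar>" and supp: "\<And>x. real R < \<bar>x\<bar> \<Longrightarrow> f x = 0"
  defines "D \<equiv> \<lambda>K::nat. (\<Sum>m\<in>{- int K..int K}. fourier_transform f (of_int m))
                 - of_real (\<Sum>a\<in>{- int R..int R}. f (of_int a))"
  shows "D \<longlonglongrightarrow> 0" and "norm (D K) \<le> 2 * ((2 * real R + 2) * L)"
proof -
  \<comment> \<open>The extra index -R - 1 lets the periodization be read at t = 1 as a sum over -R,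
    ..., R + 1, which yields \<open>G 1 = G 0\<close>.\<close>
  define J where "J = {- int R - 1..int R}"
  define G where "G t = (\<Sum>a\<in>J. f (of_int a + t))" for t
  define g where "g = (\<Sum>a\<in>{- int R..int R}. f (of_int a))"
  \<comment> \<open>A Lipschitz constant of \<open>G\<close>: one \<open>L\<close> for each of the
    2R + 2 indices in \<open>J\<close>.\<close>
  define B where "B = (2 * real R + 2) * L"
  define q where "q t = of_real (G t - g) / (unit_char t - 1)" for t
  define c where "c m = (LINT t|leb01. q t * unit_char (- (of_int m * t)))" for m :: int
  interpret prob_space leb01 by (rule prob_space_leb01)
  have L0: "0 \<le> L" using lip[of 0 1] by simp
  have B0: "0 \<le> B" using L0 by (simp add: B_def)
  have f_cont: "continuous_on UNIV f"
    by (rule lipschitz_on_continuous_on[of L], rule lipschitz_onI)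
       (use lip L0 in \<open>auto simp: dist_real_def\<close>)
  have G_cont: "continuous_on UNIV G"
    unfolding G_def by (intro continuous_intros continuous_on_compose2[OF f_cont]) auto
  have [measurable]: "G \<in> borel_measurable borel"
    by (rule borel_measurable_continuous_onI[OF G_cont])
  have q_meas [measurable]: "q \<in> borel_measurable borel" unfolding q_def by measurable
  have G_lip: "\<bar>G s - G t\<bar> \<le> B * \<bar>s - t\<bar>" for s t
  proof -
    have "\<bar>G s - G t\<bar> \<le> (\<Sum>a\<in>J. \<bar>f (of_int a + s) - f (of_int a + t)\<bar>)"
      unfolding G_def sum_subtractf[symmetric] by (rule sum_abs)
    also have "\<dots> \<le> (\<Sum>a\<in>J. L * \<bar>s - t\<bar>)"
    proof (rule sum_mono)
      fix a show "\<bar>f (of_int a + s) - f (of_int a + t)\<bar> \<le> L * \<bar>s - t\<bar>"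
        using lip[of "of_int a + s" "of_int a + t"] by simp
    qed
    also have "\<dots> = B * \<bar>s - t\<bar>" by (simp add: B_def J_def)
    finally show ?thesis .
  qed
  have G0: "G 0 = g"
  proof -
    have "J = insert (- int R - 1) {- int R..int R}" by (auto simp: J_def)
    then show ?thesis using supp[of "- real R - 1"] by (simp add: G_def g_def)
  qed
  have G1: "G 1 = g"
  proof -
    have "G 1 = (\<Sum>a\<in>{- int R..int R + 1}. f (of_int a))"
      unfolding G_def by (rule sum.reindex_bij_witness[of _ "\<lambda>a. a - 1" "\<lambda>a. a + 1"]) (auto simp: J_def)
    also have "{- int R..int R + 1} = insert (int R + 1) {- int R..int R}" by auto
    finally show ?thesis using supp[of "real R + 1"] by (simp add: g_def)
  qed
  have Gg: "\<bar>G t - g\<bar> \<le> B * norm (unit_char t - 1)" if t: "t \<in> {0..1}" for t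
  proof -
    \<comment> \<open>Compare with whichever endpoint is nearer; both values equal
      \<open>g\<close>.\<close>
    have "\<bar>G t - g\<bar> \<le> B * min t (1 - t)"
      using G_lip[of t 0] G_lip[of t 1] t by (simp add: G0 G1 min_def)
    also have "\<dots> \<le> B * norm (unit_char t - 1)"
      using t by (intro mult_left_mono norm_unit_char_minus_1_ge B0) auto
    finally show ?thesis .
  qed
  have qB: "norm (q t) \<le> B" if "t \<in> {0..1}" for t
    using Gg[OF that] B0 by (simp add: q_def norm_divide divide_le_eq del: of_real_diff)
  \<comment> \<open>Where the denominator vanishes, \<open>q t\<close> is 0 by the convention for
    division, and \<open>Gg\<close> forces \<open>G t = g\<close>, so the identity survives.\<close>
  have Gq: "of_real (G t - g) = q t * (unit_char t - 1)" if "t \<in> {0..1}" for t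
    using Gg[OF that] by (cases "unit_char t = 1") (auto simp: q_def)
  have q_int: "integrable leb01 (\<lambda>t. q t * unit_char (- (of_int m * t)))" for m
    by (rule leb01_integrable_bounded[of _ B]) (auto simp: norm_mult intro: qB)
  have e_int: "integrable leb01 (\<lambda>t. unit_char (- (of_int m * t)))" for m
    by (rule leb01_integrable_bounded[of _ 1]) auto
  have G_int: "integrable leb01 (\<lambda>t. of_real (G t) * unit_char (- (of_int m * t)))" for m
  proof (rule leb01_integrable_bounded[of _ "\<bar>g\<bar> + B"])
    fix t :: real assume "t \<in> {0..1}"
    then have "B * \<bar>t\<bar> \<le> B * 1" using B0 by (intro mult_left_mono) auto
    then show "norm (of_real (G t) * unit_char (- (of_int m * t))) \<le> \<bar>g\<bar> + B"
      using G_lip[of t 0] by (simp add: norm_mult G0)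
  qed measurable
  have coeff: "fourier_transform f (of_int m) - of_bool (m = 0) * of_real g = c (m - 1) - c m" for m
  proof -
    have "fourier_transform f (of_int m) - of_bool (m = 0) * of_real g
        = (LINT t|leb01. of_real (G t) * unit_char (- (of_int m * t)))
          - (LINT t|leb01. unit_char (- (of_int m * t)) * of_real g)"
      using fourier_transform_periodize[OF f_cont supp, where m = m] fourier_coeff_leb01[of m] e_int[of m]
      by (simp add: G_def J_def fourier_coeff_eq)
    also have "\<dots> = (LINT t|leb01. of_real (G t) * unit_char (- (of_int m * t)) - unit_char (- (of_int m * t)) * of_real g)"
      using G_int e_int by (intro Bochner_Integration.integral_diff[symmetric]) auto
    also have "\<dots> = (LINT t|leb01. q t * unit_char (- (of_int (m - 1) * t)) - q t * unit_char (- (of_int m * t)))"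
    proof (intro Bochner_Integration.integral_cong refl)
      fix t assume t: "t \<in> space leb01"
      have "of_real (G t) * unit_char (- (of_int m * t)) - unit_char (- (of_int m * t)) * of_real g
          = of_real (G t - g) * unit_char (- (of_int m * t))"
        by (simp add: algebra_simps)
      also have "\<dots> = q t * (unit_char t * unit_char (- (of_int m * t))) - q t * unit_char (- (of_int m * t))"
        by (subst Gq) (use t in \<open>auto simp: algebra_simps\<close>)
      also have "unit_char t * unit_char (- (of_int m * t)) = unit_char (- (of_int (m - 1) * t))"
        by (simp add: unit_char_add[symmetric] algebra_simps)
      finally show "of_real (G t) * unit_char (- (of_int m * t)) - unit_char (- (of_int m * t)) * of_real g
          = q t * unit_char (- (of_int (m - 1) * t)) - q t * unit_char (- (of_int m * t))" .
    qed
    also have "\<dots> = c (m - 1) - c m"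
      unfolding c_def by (intro Bochner_Integration.integral_diff q_int)
    finally show ?thesis .
  qed
  have D: "D K = c (- int K - 1) - c (int K)" for K
  proof -
    have "(\<Sum>m\<in>{- int K..int K}. of_bool (m = 0) * complex_of_real g) = of_real g"
      by (simp add: of_bool_def if_distrib[of "\<lambda>x. x * of_real g"] cong: if_cong)
    then have "D K = (\<Sum>m\<in>{- int K..int K}. fourier_transform f (of_int m) - of_bool (m = 0) * of_real g)"
      by (simp add: D_def g_def sum_subtractf)
    then show ?thesis by (simp only: coeff sum_int_telescope_symmetric)
  qed
  \<comment> \<open>Both ends of the telescope run through their frequencies injectively.\<close>
  have "(\<lambda>K. c (- int K - 1) - c (int K)) \<longlonglongrightarrow> 0 - 0"
    unfolding c_def by (intro tendsto_diff riemann_lebesgue_inj[OF q_meas qB]) (auto intro: injI)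
  moreover have "D = (\<lambda>K. c (- int K - 1) - c (int K))" by (rule ext) (rule D)
  ultimately show "D \<longlonglongrightarrow> 0" by simp
  have cB: "norm (c m) \<le> B" for m
  proof -
    have "norm (c m) \<le> (LINT t|leb01. norm (q t * unit_char (- (of_int m * t))))"
      unfolding c_def by (rule integral_norm_bound)
    also have "\<dots> \<le> (LINT t|leb01. B)"
      by (intro integral_mono_AE AE_I2 integrable_norm q_int) (auto simp: norm_mult intro: qB)
    also have "\<dots> = B" using prob_space by simp
    finally show ?thesis .
  qed
  show "norm (D K) \<le> 2 * ((2 * real R + 2) * L)"
    using norm_triangle_ineq4[of "c (- int K - 1)" "c (int K)"] cB[of "- int K - 1"] cB[of "int K"]
    unfolding D B_def[symmetric] by linarith
qed

section \<open>Fourier expansion of one coordinate\<close>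

text \<open>Outside the support f is locally constant, which gives the first claim. The second is
  integration by parts, done by integrating the derivative of f times the character over an interval
  reaching past the support.\<close>

lemma fourier_transform_deriv:
  fixes f f' :: "real \<Rightarrow> real"
  assumes der: "\<And>x. (f has_real_derivative f' x) (at x)" and cont: "continuous_on UNIV f'"
    and supp: "\<And>x. R < \<bar>x\<bar> \<Longrightarrow> f x = 0"
  shows "R < \<bar>x\<bar> \<Longrightarrow> f' x = 0"
    and "fourier_transform f' \<xi> = 2 * pi * \<xi> * \<i> * fourier_transform f \<xi>"
proof -
  show supp': "f' x = 0" if "R < \<bar>x\<bar>" for x
  proof -
    have "open {x::real. R < \<bar>x\<bar>}" by (intro open_Collect_less continuous_intros)
    then have "((\<lambda>_. 0) has_real_derivative f' x) (at x)"
      using that supp by (intro has_field_derivative_transform_within_open[OF der[of x]]) auto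
    then show ?thesis using DERIV_unique DERIV_const by blast
  qed
  have f_cont: "continuous_on UNIV f"
    using der by (meson DERIV_continuous continuous_at_imp_continuous_on)
  \<comment> \<open>Strictly beyond \<open>R\<close>, so that the boundary terms vanish, and
    nonnegative even for negative \<open>R\<close>.\<close>
  define b where "b = max 0 R + 1"
  define e where "e t = unit_char (- \<xi> * t)" for t
  have b: "0 \<le> b" "R < b" by (auto simp: b_def)
  have int: "integrable lborel (\<lambda>t. of_real (f t) * e t)" "integrable lborel (\<lambda>t. of_real (f' t) * e t)"
    unfolding e_def by (rule integrable_compact_support_times_unit_char[OF _ supp] f_cont
        integrable_compact_support_times_unit_char[OF _ supp'] cont | assumption)+
  have "(LINT t|lborel. indicator {-b..b} t *\<^sub>R (of_real (f' t) * e t - 2 * pi * \<xi> * \<i> * (of_real (f t) * e t)))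
      = of_real (f b) * e b - of_real (f (- b)) * e (- b)"
  proof (rule integral_FTC_Icc)
    fix t
    have "((\<lambda>t. complex_of_real (f t)) has_vector_derivative of_real (f' t)) (at t within {-b..b})"
      by (rule has_vector_derivative_of_real, rule has_field_derivative_at_within, rule der)
    from has_vector_derivative_mult[OF this has_vector_derivative_unit_char[of "- \<xi>" t "{-b..b}"]]
    show "((\<lambda>t. of_real (f t) * e t) has_vector_derivative
        of_real (f' t) * e t - 2 * pi * \<xi> * \<i> * (of_real (f t) * e t)) (at t within {-b..b})"
      by (simp add: e_def algebra_simps)
  qed (use b in \<open>auto simp: e_def intro!: continuous_intros continuous_on_subset[OF cont] continuous_on_subset[OF f_cont]\<close>)
  also have "\<dots> = 0" using b supp[of b] supp[of "- b"] by simp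
  also have "(LINT t|lborel. indicator {-b..b} t *\<^sub>R (of_real (f' t) * e t - 2 * pi * \<xi> * \<i> * (of_real (f t) * e t)))
      = (LINT t|lborel. of_real (f' t) * e t - 2 * pi * \<xi> * \<i> * (of_real (f t) * e t))"
  proof (intro Bochner_Integration.integral_cong refl)
    fix t
    show "indicator {-b..b} t *\<^sub>R (of_real (f' t) * e t - 2 * pi * \<xi> * \<i> * (of_real (f t) * e t))
        = of_real (f' t) * e t - 2 * pi * \<xi> * \<i> * (of_real (f t) * e t)"
      using supp[of t] supp'[of t] b by (cases "t \<in> {-b..b}") auto
  qed
  also have "\<dots> = (LINT t|lborel. of_real (f' t) * e t) - (LINT t|lborel. 2 * pi * \<xi> * \<i> * (of_real (f t) * e t))"
    using int by (intro Bochner_Integration.integral_diff) auto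
  also have "\<dots> = fourier_transform f' \<xi> - 2 * pi * \<xi> * \<i> * fourier_transform f \<xi>"
    using int by (simp add: fourier_transform_def e_def)
  finally show "fourier_transform f' \<xi> = 2 * pi * \<xi> * \<i> * fourier_transform f \<xi>" by simp
qed

lemma norm_fourier_transform_le:
  fixes f :: "real \<Rightarrow> real"
  assumes f: "continuous_on UNIV f" and supp: "\<And>x. R < \<bar>x\<bar> \<Longrightarrow> f x = 0" and R: "0 \<le> R"
    and B: "\<And>x. \<bar>f x\<bar> \<le> B"
  shows "norm (fourier_transform f \<xi>) \<le> 2 * R * B"
proof -
  have int: "integrable lborel (\<lambda>t. of_real (f t) * unit_char (- (\<xi> * t)))"
    using integrable_compact_support_times_unit_char[OF f supp, where \<xi> = "- \<xi>"] by simp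
  have "norm (fourier_transform f \<xi>) \<le> (LINT t|lborel. norm (of_real (f t) * unit_char (- (\<xi> * t))))"
    unfolding fourier_transform_def by (rule integral_norm_bound)
  also have "\<dots> \<le> (LINT t|lborel. indicator {-R..R} t *\<^sub>R B)"
  proof (rule integral_mono)
    show "integrable lborel (\<lambda>t. indicator {-R..R} t *\<^sub>R B)"
      by (rule borel_integrable_compact) auto
    fix t
    show "norm (of_real (f t) * unit_char (- (\<xi> * t))) \<le> indicator {-R..R} t *\<^sub>R B"
      using supp[of t] B[of t] by (cases "t \<in> {-R..R}") (auto simp: norm_mult)
  qed (use int in auto)
  also have "\<dots> = 2 * R * B" using R by simp
  finally show ?thesis .
qed

lemma continuous_compact_support_bounded:
  fixes f :: "real \<Rightarrow> real"
  assumes f: "continuous_on UNIV f" and supp: "\<And>x. R < \<bar>x\<bar> \<Longrightarrow> f x = 0"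
  obtains B where "0 \<le> B" "\<And>x. \<bar>f x\<bar> \<le> B"
proof -
  have "compact (f ` {-R..R})"
    by (intro compact_continuous_image continuous_on_subset[OF f]) auto
  then obtain B where B: "\<And>x. x \<in> {-R..R} \<Longrightarrow> norm (f x) \<le> B"
    using compact_imp_bounded bounded_iff by (metis imageI)
  have "\<bar>f x\<bar> \<le> max 0 B" for x
    using B[of x] supp[of x] by (cases "x \<in> {-R..R}") auto
  then show ?thesis using that[of "max 0 B"] by simp
qed

text \<open>Supplies the two analytic inputs: a Lipschitz constant for Poisson summation, and
  quadratic decay from two integrations by parts. The trivial bound on the transform covers small
  frequencies.\<close>

lemma smooth_compact_support_bounds:
  assumes w: "smooth_real w" and supp: "\<And>x. R < \<bar>x\<bar> \<Longrightarrow> w x = 0" and R: "0 \<le> R"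
  shows "\<exists>L A. 0 \<le> A \<and> (\<forall>x y. \<bar>w x - w y\<bar> \<le> L * \<bar>x - y\<bar>) \<and>
    (\<forall>\<xi>. \<xi> \<noteq> 0 \<longrightarrow> norm (fourier_transform w \<xi>) \<le> A * min 1 (1 / \<xi>\<^sup>2))"
proof -
  define w1 where "w1 = deriv w"
  define w2 where "w2 = deriv w1"
  have diff: "w differentiable (at x)" "w1 differentiable (at x)" "w2 differentiable (at x)" for x
    using w[unfolded smooth_real_def, rule_format, of 0 x] w[unfolded smooth_real_def, rule_format, of 1 x]
      w[unfolded smooth_real_def, rule_format, of 2 x]
    by (auto simp: w1_def w2_def numeral_2_eq_2)
  have d1: "(w has_real_derivative w1 x) (at x)" and d2: "(w1 has_real_derivative w2 x) (at x)" for x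
    using diff by (auto simp: w1_def w2_def DERIV_deriv_iff_real_differentiable)
  have cont: "continuous_on UNIV w" "continuous_on UNIV w1" "continuous_on UNIV w2"
    using diff by (auto intro!: continuous_at_imp_continuous_on differentiable_imp_continuous_within)
  have supp1: "w1 x = 0" if "R < \<bar>x\<bar>" for x
    by (rule fourier_transform_deriv(1)[OF d1 cont(2) supp that])
  have supp2: "w2 x = 0" if "R < \<bar>x\<bar>" for x
    by (rule fourier_transform_deriv(1)[OF d2 cont(3) supp1 that])
  obtain B0 where B0: "0 \<le> B0" "\<And>x. \<bar>w x\<bar> \<le> B0"
    using continuous_compact_support_bounded[OF cont(1) supp] by blast
  obtain B1 where B1: "0 \<le> B1" "\<And>x. \<bar>w1 x\<bar> \<le> B1"
    using continuous_compact_support_bounded[OF cont(2) supp1] by blast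
  obtain B2 where B2: "0 \<le> B2" "\<And>x. \<bar>w2 x\<bar> \<le> B2"
    using continuous_compact_support_bounded[OF cont(3) supp2] by blast
  define A where "A = 2 * R * B0 + 2 * R * B2"
  show ?thesis
  proof (rule exI[of _ B1], rule exI[of _ A], intro conjI allI impI)
    show "0 \<le> A" using R B0 B2 by (simp add: A_def)
    show "\<bar>w x - w y\<bar> \<le> B1 * \<bar>x - y\<bar>" for x y
      using field_differentiable_bound[of UNIV w w1 B1 x y] d1 B1 by auto
    show "norm (fourier_transform w \<xi>) \<le> A * min 1 (1 / \<xi>\<^sup>2)" if \<xi>: "\<xi> \<noteq> 0" for \<xi>
    proof -
      have 1: "norm (fourier_transform w \<xi>) \<le> A"
        using norm_fourier_transform_le[OF cont(1) supp R B0(2), of \<xi>] R B2 by (simp add: A_def add_increasing2)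
      have "fourier_transform w2 \<xi> = 2 * pi * \<xi> * \<i> * (2 * pi * \<xi> * \<i> * fourier_transform w \<xi>)"
        using fourier_transform_deriv(2)[OF d1 cont(2) supp] fourier_transform_deriv(2)[OF d2 cont(3) supp1]
        by simp
      then have "norm (fourier_transform w2 \<xi>) = (2 * pi)\<^sup>2 * (\<xi>\<^sup>2 * norm (fourier_transform w \<xi>))"
        by (simp add: norm_mult power2_eq_square)
      moreover have "norm (fourier_transform w2 \<xi>) \<le> A"
        using norm_fourier_transform_le[OF cont(3) supp2 R B2(2), of \<xi>] R B0 by (simp add: A_def add_increasing)
      \<comment> \<open>The gain (2 pi)^2 from differentiating twice is discarded so that one
        constant \<open>A\<close> serves both bounds.\<close>
      moreover have "1 * (\<xi>\<^sup>2 * norm (fourier_transform w \<xi>)) \<le> (2 * pi)\<^sup>2 * (\<xi>\<^sup>2 * norm (fourier_transform w \<xi>))"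
        using pi_ge_two by (intro mult_right_mono one_le_power) auto
      ultimately have "\<xi>\<^sup>2 * norm (fourier_transform w \<xi>) \<le> A" by linarith
      then have 2: "norm (fourier_transform w \<xi>) \<le> A / \<xi>\<^sup>2" using \<xi> by (simp add: field_simps)
      show ?thesis using 1 2 by (simp add: min_def)
    qed
  qed
qed

lemma fourier_transform_affine:
  assumes "0 < \<delta>"
  shows "fourier_transform (\<lambda>t. w ((t + s) / \<delta>)) \<xi> = of_real \<delta> * (unit_char (\<xi> * s) * fourier_transform w (\<xi> * \<delta>))"
proof -
  have "fourier_transform (\<lambda>t. w ((t + s) / \<delta>)) \<xi>
      = \<bar>\<delta>\<bar> *\<^sub>R (LINT u|lborel. of_real (w ((- s + \<delta> * u + s) / \<delta>)) * unit_char (- (\<xi> * (- s + \<delta> * u))))"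
    unfolding fourier_transform_def by (rule lborel_integral_real_affine) (use assms in auto)
  also have "(\<lambda>u. of_real (w ((- s + \<delta> * u + s) / \<delta>)) * unit_char (- (\<xi> * (- s + \<delta> * u))))
      = (\<lambda>u. unit_char (\<xi> * s) * (of_real (w u) * unit_char (- (\<xi> * \<delta> * u))))"
  proof
    fix u
    have "unit_char (- (\<xi> * (- s + \<delta> * u))) = unit_char (\<xi> * s) * unit_char (- (\<xi> * \<delta> * u))"
      by (simp add: unit_char_add[symmetric] algebra_simps)
    then show "of_real (w ((- s + \<delta> * u + s) / \<delta>)) * unit_char (- (\<xi> * (- s + \<delta> * u)))
        = unit_char (\<xi> * s) * (of_real (w u) * unit_char (- (\<xi> * \<delta> * u)))"
      using assms by simp
  qed
  finally show ?thesis using assms by (simp add: fourier_transform_def scaleR_conv_of_real)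
qed

text \<open>One coordinate of \<^const>\<open>A_star\<close>; the truncation \<open>cell_radius\<close> loses no nonzero term
  for arguments in the unit interval.\<close>

definition cell_radius :: "real \<Rightarrow> nat \<Rightarrow> nat" where
  "cell_radius y n = 2 * n + nat \<lceil>\<bar>y\<bar>\<rceil>"

definition cell_sum :: "(real \<Rightarrow> real) \<Rightarrow> real \<Rightarrow> real \<Rightarrow> nat \<Rightarrow> real \<Rightarrow> real" where
  "cell_sum w y d n x =
     (\<Sum>a\<in>{- int (cell_radius y n)..int (cell_radius y n)}. w ((x - (of_int a + y) / real n) / d))"

text \<open>Explains the radius 2n + |y|: the shift n x - y has size at most n + |y|, and the scaled
  support has half-width 2 n d \<le> n.\<close>

lemma cell_radius_bound:
  assumes d: "0 < d" "d \<le> 1/2" and x: "x \<in> {0..1}" and t: "real (cell_radius y n) < \<bar>t\<bar>" and n: "0 < n"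
  shows "2 < \<bar>(t + (real n * x - y)) / (real n * d)\<bar>"
proof -
  have "real n * x \<le> real n * 1" using x by (intro mult_left_mono) auto
  moreover have "0 \<le> real n * x" using x by simp
  moreover have "real (cell_radius y n) \<ge> 2 * real n + \<bar>y\<bar>"
    unfolding cell_radius_def by linarith
  moreover have "2 * (real n * d) \<le> real n"
    using mult_left_mono[OF d(2), of "2 * real n"] by simp
  ultimately have "2 * (real n * d) < \<bar>t + (real n * x - y)\<bar>" using t by linarith
  moreover have "0 < real n * d" using d n by simp
  ultimately show ?thesis by (simp only: abs_divide abs_of_pos pos_less_divide_eq)
qed

text \<open>Poisson summation for a translate of \<open>w\<close> at scale n d, evaluated at -a
  since x - (a + y)/n = (-a + (n x - y))/n. The error bound is free of \<open>x\<close> and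
  \<open>K\<close>, as dominated convergence will require.\<close>

lemma cell_sum_fourier:
  fixes w :: "real \<Rightarrow> real" and y d x L :: real and n :: nat
  assumes lip: "\<And>x y. \<bar>w x - w y\<bar> \<le> L * \<bar>x - y\<bar>" and supp: "\<And>x. 2 < \<bar>x\<bar> \<Longrightarrow> w x = 0"
    and d: "0 < d" "d \<le> 1/2" and n: "0 < n" and x: "x \<in> {0..1}"
  defines "P \<equiv> \<lambda>K::nat. \<Sum>m\<in>{- int K..int K}.
      of_real (real n * d) * (unit_char (of_int m * (real n * x - y)) * fourier_transform w (of_int m * (real n * d)))"
  shows "P \<longlonglongrightarrow> of_real (cell_sum w y d n x)"
    and "norm (P K - of_real (cell_sum w y d n x)) \<le> 2 * ((2 * real (cell_radius y n) + 2) * (L / (real n * d)))"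
proof -
  define R where "R = cell_radius y n"
  define \<delta> where "\<delta> = real n * d"
  define f where "f t = w ((t + (real n * x - y)) / \<delta>)" for t
  have \<delta>: "0 < \<delta>" using d n by (simp add: \<delta>_def)
  have f_lip: "\<bar>f s - f t\<bar> \<le> L / \<delta> * \<bar>s - t\<bar>" for s t
  proof -
    have "(s + (real n * x - y)) / \<delta> - (t + (real n * x - y)) / \<delta> = (s - t) / \<delta>"
      unfolding diff_divide_distrib[symmetric] by simp
    moreover have "\<bar>(s - t) / \<delta>\<bar> = \<bar>s - t\<bar> / \<delta>"
      using \<delta> by (simp only: abs_divide abs_of_pos)
    ultimately show ?thesis
      using lip[of "(s + (real n * x - y)) / \<delta>" "(t + (real n * x - y)) / \<delta>"]
      using \<delta> unfolding f_def by simp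
  qed
  have f_supp: "f t = 0" if "real R < \<bar>t\<bar>" for t
    unfolding f_def \<delta>_def by (rule supp[OF cell_radius_bound[OF d x that[unfolded R_def] n]])
  have cell: "(\<Sum>a\<in>{- int R..int R}. f (of_int a)) = cell_sum w y d n x"
  proof -
    have "x - (of_int a + y) / real n = (of_int (- a) + (real n * x - y)) / real n" for a
    proof -
      have "(of_int (- a) + (real n * x - y)) / real n = (real n * x - (of_int a + y)) / real n"
        by (rule arg_cong[where f = "\<lambda>z. z / real n"]) simp
      also have "\<dots> = real n * x / real n - (of_int a + y) / real n"
        by (rule diff_divide_distrib)
      also have "real n * x / real n = x" using n by simp
      finally show ?thesis by simp
    qed
    then have "(x - (of_int a + y) / real n) / d = (of_int (- a) + (real n * x - y)) / \<delta>" for a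
      by (simp only: divide_divide_eq_left \<delta>_def)
    then have "cell_sum w y d n x = (\<Sum>a\<in>{- int R..int R}. f (of_int (- a)))"
      unfolding cell_sum_def R_def[symmetric] f_def by simp
    also have "\<dots> = (\<Sum>a\<in>{- int R..int R}. f (of_int a))"
      by (rule sum.reindex_bij_witness[of _ uminus uminus]) auto
    finally show ?thesis by simp
  qed
  have P: "P K = (\<Sum>m\<in>{- int K..int K}. fourier_transform f (of_int m))" for K
    unfolding P_def f_def fourier_transform_affine[OF \<delta>] by (simp add: \<delta>_def)
  show "norm (P K - of_real (cell_sum w y d n x)) \<le> 2 * ((2 * real (cell_radius y n) + 2) * (L / (real n * d)))"
    unfolding P cell[symmetric] R_def[symmetric] \<delta>_def[symmetric]
    by (rule poisson_summation(2)[OF f_lip]) (rule f_supp)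
  have "(\<lambda>K. P K - of_real (cell_sum w y d n x)) \<longlonglongrightarrow> 0"
    unfolding P cell[symmetric] by (rule poisson_summation(1)[OF f_lip]) (rule f_supp)
  then show "P \<longlonglongrightarrow> of_real (cell_sum w y d n x)" by (rule LIM_zero_cancel)
qed

section \<open>Discrepancy of one coordinate\<close>

text \<open>Covers both kinds of measure at once: Borel measures on the line with full mass on the
  unit interval, and \<open>leb01\<close>, whose space and sigma-algebra are restricted to that
  interval. Hence measurability of the identity takes the place of an equation between
  sigma-algebras.\<close>

locale unit_interval_prob = prob_space \<nu> for \<nu> :: "real measure" +
  assumes id_measurable: "(\<lambda>x. x) \<in> borel_measurable \<nu>"
    and AE_unit: "AE x in \<nu>. x \<in> {0..1}"
begin

lemma measurable_from_borel: "f \<in> borel_measurable borel \<Longrightarrow> f \<in> borel_measurable \<nu>"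
  by (rule measurable_compose[OF id_measurable])

lemma norm_fourier_coeff_le_1: "norm (fourier_coeff \<nu> m) \<le> 1"
proof -
  have "norm (fourier_coeff \<nu> m) \<le> (LINT x|\<nu>. norm (unit_char (- (of_int m * x))))"
    unfolding fourier_coeff_eq by (rule integral_norm_bound)
  then show ?thesis using prob_space by simp
qed

lemma norm_fourier_coeff_minus: "norm (fourier_coeff \<nu> (- m)) = norm (fourier_coeff \<nu> m)"
proof -
  have "fourier_coeff \<nu> (- m) = (LINT x|\<nu>. cnj (unit_char (- (of_int m * x))))"
    by (simp add: fourier_coeff_eq cnj_unit_char)
  then show ?thesis by (simp add: fourier_coeff_eq)
qed

end

lemma unit_interval_prob_leb01: "unit_interval_prob leb01"
  by (intro unit_interval_prob.intro prob_space_leb01 unit_interval_prob_axioms.intro leb01_id_measurable)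
     (rule AE_I2, simp)

lemma unit_interval_prob_borel:
  assumes "sets \<nu> = sets borel" "prob_space \<nu>" "measure \<nu> {0..1} = 1"
  shows "unit_interval_prob \<nu>"
proof (intro unit_interval_prob.intro unit_interval_prob_axioms.intro assms(2))
  interpret prob_space \<nu> by fact
  show "(\<lambda>x. x) \<in> borel_measurable \<nu>"
    by (rule measurable_ident_sets[OF assms(1)])
  show "AE x in \<nu>. x \<in> {0..1}"
    using assms by (subst prob_eq_1[symmetric]) auto
qed

locale test_function =
  fixes w :: "real \<Rightarrow> real" and L A :: real
  assumes w_range: "0 \<le> w x" "w x \<le> 1"
    and w_supp: "2 < \<bar>x\<bar> \<Longrightarrow> w x = 0"
    and w_lip: "\<bar>w x - w x'\<bar> \<le> L * \<bar>x - x'\<bar>"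
    and A_nonneg: "0 \<le> A"
    and w_decay: "\<xi> \<noteq> 0 \<Longrightarrow> norm (fourier_transform w \<xi>) \<le> A * min 1 (1 / \<xi>\<^sup>2)"
begin

lemma w_continuous: "continuous_on UNIV w"
proof -
  have "0 \<le> L" using w_lip[of 0 1] by simp
  then show ?thesis
    by (intro lipschitz_on_continuous_on[of L] lipschitz_onI) (auto simp: dist_real_def w_lip)
qed

lemma fourier_transform_0_le: "norm (fourier_transform w 0) \<le> 4"
  using norm_fourier_transform_le[where f = w and R = 2 and B = 1 and \<xi> = 0, OF w_continuous w_supp] w_range
  by (auto simp: abs_le_iff intro: order_trans[of _ 0])

lemma cell_sum_measurable: "cell_sum w y d n \<in> borel_measurable borel"
proof -
  have [measurable]: "w \<in> borel_measurable borel"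
    by (rule borel_measurable_continuous_onI[OF w_continuous])
  show ?thesis unfolding cell_sum_def[abs_def] by measurable
qed

lemma cell_sum_nonneg: "0 \<le> cell_sum w y d n x"
  unfolding cell_sum_def by (simp add: sum_nonneg w_range)

lemma cell_sum_le: "cell_sum w y d n x \<le> 2 * real (cell_radius y n) + 1"
proof -
  have "cell_sum w y d n x \<le> (\<Sum>a\<in>{- int (cell_radius y n)..int (cell_radius y n)}. 1)"
    unfolding cell_sum_def by (intro sum_mono w_range)
  then show ?thesis by simp
qed

lemma cell_sum_integrable:
  assumes "unit_interval_prob \<nu>"
  shows "integrable \<nu> (cell_sum w y d n)"
proof -
  interpret unit_interval_prob \<nu> by fact
  show ?thesis
    using cell_sum_nonneg cell_sum_le
    by (intro integrable_const_bound[of _ "2 * real (cell_radius y n) + 1"] AE_I2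
          measurable_from_borel cell_sum_measurable) auto
qed

text \<open>The constant \<open>B + D\<close> dominates all partial sums on the unit interval, so
  they may be integrated termwise. The coefficient sits at -(m n) because
  \<open>fourier_coeff\<close> carries a minus sign in its exponent.\<close>

lemma cell_sum_integral_fourier:
  assumes \<nu>: "unit_interval_prob \<nu>" and d: "0 < d" "d \<le> 1/2" and n: "0 < n"
  shows "(\<lambda>K. \<Sum>m\<in>{- int K..int K}. of_real (real n * d) * (unit_char (- (of_int m * y))
            * fourier_transform w (of_int m * (real n * d))) * fourier_coeff \<nu> (- (m * int n)))
         \<longlonglongrightarrow> of_real (LINT x|\<nu>. cell_sum w y d n x)"
proof -
  interpret unit_interval_prob \<nu> by fact
  define c where "c m = of_real (real n * d) * (unit_char (- (of_int m * y))
            * fourier_transform w (of_int m * (real n * d)))" for m :: int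
  define P where "P K x = (\<Sum>m\<in>{- int K..int K}. c m * unit_char (of_int (m * int n) * x))" for K :: nat and x
  define B where "B = 2 * ((2 * real (cell_radius y n) + 2) * (L / (real n * d)))"
  define D where "D = 2 * real (cell_radius y n) + 1"
  have P: "P K x = (\<Sum>m\<in>{- int K..int K}. of_real (real n * d)
      * (unit_char (of_int m * (real n * x - y)) * fourier_transform w (of_int m * (real n * d))))" for K x
    unfolding P_def
  proof (intro sum.cong refl)
    fix m
    have "unit_char (of_int m * (real n * x - y)) = unit_char (- (of_int m * y)) * unit_char (of_int (m * int n) * x)"
      by (simp add: unit_char_add[symmetric] algebra_simps)
    then show "c m * unit_char (of_int (m * int n) * x) = of_real (real n * d)
      * (unit_char (of_int m * (real n * x - y)) * fourier_transform w (of_int m * (real n * d)))"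
      by (simp add: c_def mult_ac)
  qed
  have conv: "(\<lambda>K. P K x) \<longlonglongrightarrow> of_real (cell_sum w y d n x)"
    and bd: "norm (P K x) \<le> B + D" if x: "x \<in> {0..1}" for x K
  proof -
    show "(\<lambda>K. P K x) \<longlonglongrightarrow> of_real (cell_sum w y d n x)"
      unfolding P by (rule cell_sum_fourier(1)[OF w_lip w_supp d n x])
    have "norm (P K x - of_real (cell_sum w y d n x)) \<le> B"
      unfolding P B_def by (rule cell_sum_fourier(2)[OF w_lip w_supp d n x])
    moreover have "norm (complex_of_real (cell_sum w y d n x)) \<le> D"
      using cell_sum_nonneg[of y d n x] cell_sum_le[of y d n x] by (simp add: D_def)
    ultimately show "norm (P K x) \<le> B + D"
      using norm_triangle_sub[of "P K x" "of_real (cell_sum w y d n x)"] by linarith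
  qed
  have "(\<lambda>K. LINT x|\<nu>. P K x) \<longlonglongrightarrow> (LINT x|\<nu>. complex_of_real (cell_sum w y d n x))"
  proof (rule integral_dominated_convergence[where w = "\<lambda>_. B + D"])
    show "(\<lambda>x. complex_of_real (cell_sum w y d n x)) \<in> borel_measurable \<nu>"
    proof (rule measurable_from_borel)
      note cell_sum_measurable [measurable]
      show "(\<lambda>x. complex_of_real (cell_sum w y d n x)) \<in> borel_measurable borel" by measurable
    qed
    show "P K \<in> borel_measurable \<nu>" for K
      by (intro measurable_from_borel) (simp add: P_def[abs_def])
    show "AE x in \<nu>. (\<lambda>K. P K x) \<longlonglongrightarrow> of_real (cell_sum w y d n x)"
      using AE_unit by eventually_elim (rule conv)
    show "AE x in \<nu>. norm (P K x) \<le> B + D" for K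
      using AE_unit by eventually_elim (rule bd)
  qed simp
  moreover have "(LINT x|\<nu>. P K x) = (\<Sum>m\<in>{- int K..int K}. c m * fourier_coeff \<nu> (- (m * int n)))" for K
  proof -
    have "integrable \<nu> (\<lambda>x. unit_char (of_int (m * int n) * x))" for m
      by (intro integrable_const_bound[of _ 1] AE_I2 measurable_from_borel) simp_all
    then show ?thesis
      unfolding P_def by (subst Bochner_Integration.integral_sum) (auto simp: fourier_coeff_eq)
  qed
  ultimately show ?thesis by (simp add: c_def)
qed

text \<open>As n > 0, only m = 0 meets a nonzero Lebesgue coefficient, so the partial sums do not
  depend on \<open>K\<close>.\<close>

lemma cell_sum_integral_leb01:
  assumes d: "0 < d" "d \<le> 1/2" and n: "0 < n"
  shows "complex_of_real (LINT x|leb01. cell_sum w y d n x) = of_real (real n * d) * fourier_transform w 0"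
proof -
  have eq: "(\<Sum>m\<in>{- int K..int K}. of_real (real n * d) * (unit_char (- (of_int m * y))
            * fourier_transform w (of_int m * (real n * d))) * fourier_coeff leb01 (- (m * int n)))
        = of_real (real n * d) * fourier_transform w 0" for K
  proof -
    have "(\<Sum>m\<in>{- int K..int K}. of_real (real n * d) * (unit_char (- (of_int m * y))
            * fourier_transform w (of_int m * (real n * d))) * fourier_coeff leb01 (- (m * int n)))
        = (\<Sum>m\<in>{- int K..int K}. if m = 0 then of_real (real n * d) * fourier_transform w 0 else 0)"
      using n by (intro sum.cong) (auto simp: fourier_coeff_leb01)
    then show ?thesis by simp
  qed
  show ?thesis
    using cell_sum_integral_fourier[OF unit_interval_prob_leb01 d n, of y] unfolding eq
    by (simp add: LIMSEQ_const_iff)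
qed

lemma abs_cell_sum_integral_leb01_le:
  assumes d: "0 < d" "d \<le> 1/2" and n: "0 < n"
  shows "\<bar>LINT x|leb01. cell_sum w y d n x\<bar> \<le> real n * d * 4"
proof -
  have "\<bar>LINT x|leb01. cell_sum w y d n x\<bar> = norm (complex_of_real (LINT x|leb01. cell_sum w y d n x))"
    by simp
  also have "\<dots> = real n * d * norm (fourier_transform w 0)"
    unfolding cell_sum_integral_leb01[OF d n] using d by (simp add: norm_mult)
  also have "\<dots> \<le> real n * d * 4"
    using d fourier_transform_0_le by (intro mult_left_mono) auto
  finally show ?thesis .
qed

text \<open>The zero frequency of a probability measure reproduces the Lebesgue integral, so each
  discrepancy is a limit of symmetric sums over m \<noteq> 0. A bound \<open>T\<close> uniform in
  the cutoff \<open>K\<close> passes to the limit, so all double sums stay finite.\<close>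

lemma cell_sum_discrepancy_le:
  assumes \<nu>: "unit_interval_prob \<nu>" and d: "0 < d" "d \<le> 1/2"
    and S: "finite S" "\<And>n. n \<in> S \<Longrightarrow> 0 < n"
    and T: "\<And>K. (\<Sum>n\<in>S. \<Sum>m | m \<noteq> 0 \<and> \<bar>m\<bar> \<le> int K. real n * d *
        (norm (fourier_transform w (of_int m * (real n * d))) * norm (fourier_coeff \<nu> (m * int n)))) \<le> T"
  shows "(\<Sum>n\<in>S. \<bar>(LINT x|\<nu>. cell_sum w y d n x) - (LINT x|leb01. cell_sum w y d n x)\<bar>) \<le> T"
proof -
  interpret unit_interval_prob \<nu> by fact
  define c where "c n m = of_real (real n * d) * (unit_char (- (of_int m * y))
            * fourier_transform w (of_int m * (real n * d))) * fourier_coeff \<nu> (- (m * int n))" for n :: nat and m :: int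
  define \<Delta> where "\<Delta> n = (LINT x|\<nu>. cell_sum w y d n x) - (LINT x|leb01. cell_sum w y d n x)" for n
  have c0: "c n 0 = complex_of_real (LINT x|leb01. cell_sum w y d n x)" if "n \<in> S" for n
    using prob_space cell_sum_integral_leb01[OF d S(2)[OF that], of y] by (simp add: c_def fourier_coeff_eq)
  have "(\<lambda>K. \<Sum>m | m \<noteq> 0 \<and> \<bar>m\<bar> \<le> int K. c n m) \<longlonglongrightarrow> of_real (\<Delta> n)" if n: "n \<in> S" for n
  proof -
    have "(\<Sum>m\<in>{- int K..int K}. c n m) - c n 0 = (\<Sum>m | m \<noteq> 0 \<and> \<bar>m\<bar> \<le> int K. c n m)" for K
    proof -
      have "{- int K..int K} = insert 0 {m. m \<noteq> 0 \<and> \<bar>m\<bar> \<le> int K}" by auto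
      moreover have "finite {m. m \<noteq> 0 \<and> \<bar>m\<bar> \<le> int K}"
        by (rule finite_subset[of _ "{- int K..int K}"]) auto
      ultimately show ?thesis by simp
    qed
    moreover have "(\<lambda>K. (\<Sum>m\<in>{- int K..int K}. c n m) - c n 0) \<longlonglongrightarrow> of_real (LINT x|\<nu>. cell_sum w y d n x) - c n 0"
      unfolding c_def by (intro tendsto_diff tendsto_const cell_sum_integral_fourier \<nu> d S(2) n)
    ultimately show ?thesis using c0[OF n] by (simp add: \<Delta>_def)
  qed
  then have "(\<lambda>K. \<Sum>n\<in>S. norm (\<Sum>m | m \<noteq> 0 \<and> \<bar>m\<bar> \<le> int K. c n m)) \<longlonglongrightarrow> (\<Sum>n\<in>S. norm (complex_of_real (\<Delta> n)))"
    by (intro tendsto_sum tendsto_norm)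
  moreover have "(\<Sum>n\<in>S. norm (\<Sum>m | m \<noteq> 0 \<and> \<bar>m\<bar> \<le> int K. c n m)) \<le> T" for K
  proof -
    have "(\<Sum>n\<in>S. norm (\<Sum>m | m \<noteq> 0 \<and> \<bar>m\<bar> \<le> int K. c n m)) \<le> (\<Sum>n\<in>S. \<Sum>m | m \<noteq> 0 \<and> \<bar>m\<bar> \<le> int K. norm (c n m))"
      by (intro sum_mono norm_sum)
    also have "\<dots> = (\<Sum>n\<in>S. \<Sum>m | m \<noteq> 0 \<and> \<bar>m\<bar> \<le> int K. real n * d *
        (norm (fourier_transform w (of_int m * (real n * d))) * norm (fourier_coeff \<nu> (m * int n))))"
      using d by (intro sum.cong refl) (simp add: c_def norm_mult norm_fourier_coeff_minus)
    finally show ?thesis using T[of K] by linarith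
  qed
  ultimately have "(\<Sum>n\<in>S. norm (complex_of_real (\<Delta> n))) \<le> T"
    by (intro LIMSEQ_le_const2) auto
  then have "(\<Sum>n\<in>S. \<bar>\<Delta> n\<bar>) \<le> T" by simp
  then show ?thesis by (simp only: \<Delta>_def)
qed

text \<open>Each term carries the prefactor n d \<le> 2 N d; its factor d turns d^(s - 1 -
  \<epsilon>) from the weighted sum into d^(s - \<epsilon>). The constant depends on neither
  \<open>N\<close>, \<open>y\<close> nor \<open>d\<close>.\<close>

lemma cell_sum_discrepancy_bound:
  assumes \<nu>: "unit_interval_prob \<nu>" and s: "0 \<le> s" and \<epsilon>: "0 < \<epsilon>" "\<epsilon> \<le> 1/2"
    and C: "\<And>Q::real. Q \<ge> 1 \<Longrightarrow>
      (\<Sum>\<xi> | \<bar>real_of_int \<xi>\<bar> \<le> Q. norm (fourier_coeff \<nu> \<xi>)) \<le> C * Q powr (1 - s)"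
  obtains C' where "0 \<le> C'" "\<And>N y d. 0 < d \<Longrightarrow> d \<le> 1/2 \<Longrightarrow>
      (\<Sum>n\<in>{N..<2*N}. \<bar>(LINT x|\<nu>. cell_sum w y d n x) - (LINT x|leb01. cell_sum w y d n x)\<bar>)
        \<le> C' * real N * d powr (s - \<epsilon>)"
proof -
  obtain Ct where Ct: "Ct > 0" "\<And>n::nat. n > 0 \<Longrightarrow> real (card {e. e dvd n}) \<le> Ct * real n powr \<epsilon>"
    using divisor_bound[OF \<epsilon>(1)] by blast
  define b where "b \<xi> = norm (fourier_coeff \<nu> \<xi>)" for \<xi>
  define G where "G = 4 / (1 - 2 powr (-1/2)) * C"
  have "0 \<le> (\<Sum>\<xi> | \<bar>real_of_int \<xi>\<bar> \<le> 1. norm (fourier_coeff \<nu> \<xi>))" by (rule sum_nonneg) simp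
  then have "0 \<le> C" using C[of 1] by simp
  moreover have "(2::real) powr (-1/2) < 1" by (simp add: powr_less_one)
  ultimately have G0: "0 \<le> G" by (simp add: G_def)
  show ?thesis
  proof (rule that[of "2 * A * Ct * G"])
    show "0 \<le> 2 * A * Ct * G" using A_nonneg Ct G0 by simp
    fix N :: nat and y d :: real assume d: "0 < d" "d \<le> 1/2"
    \<comment> \<open>The decay of the transform at m n d sees m and n only through \<xi> = m n, as
      does the coefficient of \<nu>; this makes grouping by \<xi> possible.\<close>
    define h where "h \<xi> = min 1 (1 / (\<bar>real_of_int \<xi>\<bar> * d)\<^sup>2) * b \<xi>" for \<xi>
    have h0: "0 \<le> h \<xi>" for \<xi> by (simp add: h_def b_def)
    show "(\<Sum>n\<in>{N..<2*N}. \<bar>(LINT x|\<nu>. cell_sum w y d n x) - (LINT x|leb01. cell_sum w y d n x)\<bar>)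
        \<le> 2 * A * Ct * G * real N * d powr (s - \<epsilon>)"
    proof (rule cell_sum_discrepancy_le[OF \<nu> d])
      show "0 < n" if "n \<in> {N..<2*N}" for n using that by (cases n) auto
      fix K :: nat
      define X where "X = 2 * N * K"
      have "(\<Sum>n\<in>{N..<2*N}. \<Sum>m | m \<noteq> 0 \<and> \<bar>m\<bar> \<le> int K. real n * d *
          (norm (fourier_transform w (of_int m * (real n * d))) * norm (fourier_coeff \<nu> (m * int n))))
        \<le> (\<Sum>n\<in>{N..<2*N}. \<Sum>m | m \<noteq> 0 \<and> \<bar>m\<bar> \<le> int K. 2 * real N * d * (A * h (m * int n)))"
      proof (intro sum_mono)
        fix n m assume n: "n \<in> {N..<2*N}" and m: "m \<in> {m. m \<noteq> 0 \<and> \<bar>m\<bar> \<le> int K}"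
        have "n > 0" using n by (cases n) auto
        then have "of_int m * (real n * d) \<noteq> 0" using m d by simp
        then have "norm (fourier_transform w (of_int m * (real n * d)))
            \<le> A * min 1 (1 / (of_int m * (real n * d))\<^sup>2)" by (rule w_decay)
        also have "(of_int m * (real n * d))\<^sup>2 = (\<bar>real_of_int (m * int n)\<bar> * d)\<^sup>2"
          by (simp add: power_mult_distrib)
        finally have "norm (fourier_transform w (of_int m * (real n * d))) * b (m * int n)
            \<le> A * min 1 (1 / (\<bar>real_of_int (m * int n)\<bar> * d)\<^sup>2) * b (m * int n)"
          by (rule mult_right_mono) (simp add: b_def)
        then have "norm (fourier_transform w (of_int m * (real n * d))) * norm (fourier_coeff \<nu> (m * int n))
            \<le> A * h (m * int n)"
          by (simp only: h_def b_def mult.assoc)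
        moreover have "real n * d \<le> 2 * real N * d"
          using n d by (intro mult_right_mono) auto
        ultimately show "real n * d *
            (norm (fourier_transform w (of_int m * (real n * d))) * norm (fourier_coeff \<nu> (m * int n)))
            \<le> 2 * real N * d * (A * h (m * int n))"
          using d by (intro mult_mono[of "real n * d"]) auto
      qed
      also have "\<dots> = 2 * real N * d * A * (\<Sum>n\<in>{N..<2*N}. \<Sum>m | m \<noteq> 0 \<and> \<bar>m\<bar> \<le> int K. h (m * int n))"
        by (simp add: sum_distrib_left mult_ac)
      also have "\<dots> \<le> 2 * real N * d * A *
          (\<Sum>\<xi> | \<xi> \<noteq> 0 \<and> \<bar>\<xi>\<bar> \<le> int X. real (card {e. e dvd nat \<bar>\<xi>\<bar>}) * h \<xi>)"
      proof (intro mult_left_mono sum_multiples_le_divisor_sum h0)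
        show "0 < n \<and> n * K \<le> X" if "n \<in> {N..<2*N}" for n
        proof
          show "0 < n" using that by (cases n) auto
          have "n \<le> 2 * N" using that by simp
          then show "n * K \<le> X" unfolding X_def by (rule mult_le_mono1)
        qed
      qed (use d A_nonneg in auto)
      also have "\<dots> \<le> 2 * real N * d * A *
          (\<Sum>\<xi> | \<xi> \<noteq> 0 \<and> \<bar>\<xi>\<bar> \<le> int X. Ct * (\<bar>real_of_int \<xi>\<bar> powr \<epsilon> * h \<xi>))"
      proof (intro mult_left_mono sum_mono)
        fix \<xi> :: int assume "\<xi> \<in> {\<xi>. \<xi> \<noteq> 0 \<and> \<bar>\<xi>\<bar> \<le> int X}"
        then have "real (card {e. e dvd nat \<bar>\<xi>\<bar>}) \<le> Ct * real (nat \<bar>\<xi>\<bar>) powr \<epsilon>"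
          by (intro Ct) auto
        then have "real (card {e. e dvd nat \<bar>\<xi>\<bar>}) * h \<xi> \<le> Ct * \<bar>real_of_int \<xi>\<bar> powr \<epsilon> * h \<xi>"
          by (intro mult_right_mono h0) simp
        then show "real (card {e. e dvd nat \<bar>\<xi>\<bar>}) * h \<xi> \<le> Ct * (\<bar>real_of_int \<xi>\<bar> powr \<epsilon> * h \<xi>)"
          by (simp add: mult.assoc)
      qed (use d A_nonneg in auto)
      also have "\<dots> = 2 * real N * d * A * Ct * (\<Sum>\<xi> | \<xi> \<noteq> 0 \<and> \<bar>\<xi>\<bar> \<le> int X.
            \<bar>real_of_int \<xi>\<bar> powr \<epsilon> * min 1 (1 / (\<bar>real_of_int \<xi>\<bar> * d)\<^sup>2) * b \<xi>)"
        by (simp add: sum_distrib_left h_def mult.assoc)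
      also have "\<dots> \<le> 2 * real N * d * A * Ct * (G * d powr (s - 1 - \<epsilon>))"
      proof (rule mult_left_mono)
        show "(\<Sum>\<xi> | \<xi> \<noteq> 0 \<and> \<bar>\<xi>\<bar> \<le> int X.
            \<bar>real_of_int \<xi>\<bar> powr \<epsilon> * min 1 (1 / (\<bar>real_of_int \<xi>\<bar> * d)\<^sup>2) * b \<xi>) \<le> G * d powr (s - 1 - \<epsilon>)"
          unfolding G_def by (rule weighted_sum_bound) (use s \<epsilon> d C in \<open>auto simp: b_def\<close>)
      qed (use d A_nonneg Ct in auto)
      also have "\<dots> = 2 * A * Ct * G * real N * (d powr 1 * d powr (s - 1 - \<epsilon>))"
        using d by simp
      also have "d powr 1 * d powr (s - 1 - \<epsilon>) = d powr (s - \<epsilon>)"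
        by (simp only: powr_add[symmetric]) simp
      finally show "(\<Sum>n\<in>{N..<2*N}. \<Sum>m | m \<noteq> 0 \<and> \<bar>m\<bar> \<le> int K. real n * d *
          (norm (fourier_transform w (of_int m * (real n * d))) * norm (fourier_coeff \<nu> (m * int n))))
        \<le> 2 * A * Ct * G * real N * d powr (s - \<epsilon>)" .
    qed simp
  qed
qed

end

section \<open>Product structure\<close>

context unit_interval_prob
begin

definition l1_exponents :: "real set" where
  "l1_exponents = {s. s \<ge> 0 \<and> (\<exists>C. \<forall>Q::real. Q \<ge> 1 \<longrightarrow>
      (\<Sum>\<xi>\<in>{\<xi>::int. \<bar>real_of_int \<xi>\<bar> \<le> Q}. cmod (fourier_coeff \<nu> \<xi>)) \<le> C * Q powr (1 - s))}"

lemma dim_l1_eq: "dim_l1 \<nu> = Sup l1_exponents"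
  by (simp add: dim_l1_def l1_exponents_def)

lemma zero_in_l1_exponents: "0 \<in> l1_exponents"
proof -
  have "(\<Sum>\<xi> | \<bar>real_of_int \<xi>\<bar> \<le> Q. cmod (fourier_coeff \<nu> \<xi>)) \<le> 3 * Q powr (1 - 0)" if Q: "Q \<ge> 1" for Q
  proof -
    have "{\<xi>. \<bar>real_of_int \<xi>\<bar> \<le> Q} = {- \<lfloor>Q\<rfloor>..\<lfloor>Q\<rfloor>}"
      by (auto simp: le_floor_iff abs_le_iff minus_le_iff)
    then have "(\<Sum>\<xi> | \<bar>real_of_int \<xi>\<bar> \<le> Q. cmod (fourier_coeff \<nu> \<xi>)) \<le> (\<Sum>\<xi>\<in>{- \<lfloor>Q\<rfloor>..\<lfloor>Q\<rfloor>}. 1)"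
      by (simp only:) (intro sum_mono norm_fourier_coeff_le_1)
    also have "\<dots> = 2 * of_int \<lfloor>Q\<rfloor> + 1" using Q by simp
    also have "\<dots> \<le> 3 * Q" using Q of_int_floor_le[of Q] by linarith
    finally show ?thesis using Q by simp
  qed
  then show ?thesis by (auto simp: l1_exponents_def)
qed

text \<open>The zero frequency alone contributes 1 to every sum, which C Q^(1-s) cannot dominate for
  large Q once s > 1. The \<open>Q\<close> chosen makes Q^(1-s) equal to 1/(|C| + 1).\<close>

lemma l1_exponents_le_1:
  assumes "s \<in> l1_exponents"
  shows "s \<le> 1"
proof (rule ccontr)
  assume s: "\<not> s \<le> 1"
  obtain C where C: "\<And>Q::real. Q \<ge> 1 \<Longrightarrow>
      (\<Sum>\<xi> | \<bar>real_of_int \<xi>\<bar> \<le> Q. cmod (fourier_coeff \<nu> \<xi>)) \<le> C * Q powr (1 - s)"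
    using assms by (auto simp: l1_exponents_def)
  have one: "1 \<le> C * Q powr (1 - s)" if Q: "Q \<ge> 1" for Q
  proof -
    have "finite {\<xi>. \<bar>real_of_int \<xi>\<bar> \<le> Q}"
      by (rule finite_subset[of _ "{-\<lceil>Q\<rceil>..\<lceil>Q\<rceil>}"]) (auto, linarith+)
    then have "cmod (fourier_coeff \<nu> 0) \<le> (\<Sum>\<xi> | \<bar>real_of_int \<xi>\<bar> \<le> Q. cmod (fourier_coeff \<nu> \<xi>))"
      using Q by (intro member_le_sum) auto
    moreover have "cmod (fourier_coeff \<nu> 0) = 1" using prob_space by (simp add: fourier_coeff_eq)
    ultimately show ?thesis using C[OF Q] by linarith
  qed
  define Q where "Q = (\<bar>C\<bar> + 1) powr (1 / (s - 1))"
  have "Q \<ge> 1" unfolding Q_def using s by (intro ge_one_powr_ge_zero) auto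
  moreover have "Q powr (1 - s) = 1 / (\<bar>C\<bar> + 1)"
  proof -
    have "1 / (s - 1) * (1 - s) = - 1" using s by (simp add: divide_simps)
    then show ?thesis by (simp only: Q_def powr_powr) (simp add: powr_minus_divide)
  qed
  ultimately have "1 \<le> C * (1 / (\<bar>C\<bar> + 1))" using one by metis
  then have "\<bar>C\<bar> + 1 \<le> C" by (simp add: pos_le_divide_eq)
  then show False by linarith
qed

text \<open>Needed to absorb the Lebesgue factor: d \<le> d^(dim - \<epsilon>) for d \<le>
  1.\<close>

lemma dim_l1_le_1: "dim_l1 \<nu> \<le> 1"
  unfolding dim_l1_eq using zero_in_l1_exponents l1_exponents_le_1 by (intro cSup_least) auto

text \<open>The supremum may not be attained, so an admissible exponent just below it stands
  in.\<close>

lemma dim_l1_approx: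
  assumes "\<epsilon> > 0"
  obtains s C where "0 \<le> s" "dim_l1 \<nu> - \<epsilon> < s"
    "\<And>Q::real. Q \<ge> 1 \<Longrightarrow> (\<Sum>\<xi> | \<bar>real_of_int \<xi>\<bar> \<le> Q. cmod (fourier_coeff \<nu> \<xi>)) \<le> C * Q powr (1 - s)"
proof -
  have "dim_l1 \<nu> - \<epsilon> < Sup l1_exponents" using assms by (simp add: dim_l1_eq)
  then obtain s where "s \<in> l1_exponents" "dim_l1 \<nu> - \<epsilon> < s"
    using less_cSupD zero_in_l1_exponents by (metis empty_iff)
  then show ?thesis using that by (auto simp: l1_exponents_def)
qed

end

section \<open>From one coordinate to the product\<close>

context test_function
begin

text \<open>On the cube every lattice point outside a finite box has a vanishing factor, so the
  infinite sum is finite and distributivity over the box applies.\<close>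

lemma A_star_eq_prod_cell_sum:
  assumes d: "\<And>j. j < k \<Longrightarrow> 0 < d j \<and> d j \<le> 1/2" and n: "0 < n"
    and x: "\<And>j. j < k \<Longrightarrow> x j \<in> {0..1}"
  shows "A_star w k y d n x = (\<Prod>j<k. cell_sum w (y j) (d j) n (x j))"
proof -
  define R where "R j = cell_radius (y j) n" for j
  define u where "u j a = w ((x j - (of_int a + y j) / real n) / d j)" for j and a :: int
  have u0: "u j a = 0" if j: "j < k" and a: "a \<notin> {- int (R j)..int (R j)}" for j a
  proof -
    have "real (cell_radius (y j) n) < \<bar>of_int (- a)\<bar>" using a by (auto simp: R_def)
    then have "2 < \<bar>(of_int (- a) + (real n * x j - y j)) / (real n * d j)\<bar>"
      using d[OF j] n by (intro cell_radius_bound x j) auto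
    moreover have "(x j - (of_int a + y j) / real n) / d j = (of_int (- a) + (real n * x j - y j)) / (real n * d j)"
    proof -
      have "x j - (of_int a + y j) / real n = (real n * x j - (of_int a + y j)) / real n"
        using n by (simp add: diff_divide_distrib)
      also have "real n * x j - (of_int a + y j) = of_int (- a) + (real n * x j - y j)" by simp
      finally show ?thesis by (simp only: divide_divide_eq_left)
    qed
    ultimately show ?thesis unfolding u_def by (simp only: w_supp)
  qed
  define F where "F = PiE {..<k} (\<lambda>j. {- int (R j)..int (R j)})"
  have finF: "finite F" unfolding F_def by (intro finite_PiE) auto
  have "A_star w k y d n x = (\<Sum>\<^sub>\<infinity>a\<in>lattice k. \<Prod>j<k. u j (a j))"
    by (simp add: A_star_def u_def)
  also have "\<dots> = (\<Sum>\<^sub>\<infinity>a\<in>F. \<Prod>j<k. u j (a j))"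
  proof (rule infsum_cong_neutral)
    fix a assume "a \<in> lattice k - F"
    then obtain j where "j < k" "a j \<notin> {- int (R j)..int (R j)}"
      by (auto simp: lattice_def F_def PiE_iff)
    then show "(\<Prod>j<k. u j (a j)) = 0" using u0 by (intro prod_zero) auto
  qed (auto simp: lattice_def F_def PiE_iff)
  also have "\<dots> = (\<Sum>a\<in>F. \<Prod>j<k. u j (a j))" using finF by simp
  also have "\<dots> = (\<Prod>j<k. \<Sum>a\<in>{- int (R j)..int (R j)}. u j a)"
    unfolding F_def by (rule prod_sum_PiE[symmetric]) auto
  finally show ?thesis by (simp add: cell_sum_def R_def u_def)
qed

lemma cube_integral_A_star:
  assumes M: "\<And>j. j < k \<Longrightarrow> unit_interval_prob (M j)"
    and d: "\<And>j. j < k \<Longrightarrow> 0 < d j \<and> d j \<le> 1/2" and n: "0 < n"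
  shows "cube_integral k (PiM {..<k} M) (A_star w k y d n) = (\<Prod>j<k. LINT x|M j. cell_sum w (y j) (d j) n x)"
proof -
  \<comment> \<open>The product locale asks for a sigma-finite measure at every index, while
    \<open>M\<close> is constrained only below \<open>k\<close>.\<close>
  define M' where "M' j = (if j < k then M j else leb01)" for j
  have M': "unit_interval_prob (M' j)" for j
    by (simp add: M'_def M unit_interval_prob_leb01)
  then interpret product_sigma_finite M'
    by (intro product_sigma_finite.intro) (simp add: unit_interval_prob_def prob_space_imp_sigma_finite)
  \<comment> \<open>The factorisation of \<open>A_star\<close> is available only on the cube;
    distributing the cube's indicator over the coordinates makes it hold everywhere.\<close>
  define g where "g j x = indicator {0..1} x * cell_sum w (y j) (d j) n x" for j and x :: real
  have g_meas: "g j \<in> borel_measurable (M' j)" for j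
  proof -
    interpret unit_interval_prob "M' j" by (rule M')
    note cell_sum_measurable [measurable]
    show ?thesis unfolding g_def by (rule measurable_from_borel) measurable
  qed
  have g_AE: "AE x in M' j. g j x = cell_sum w (y j) (d j) n x" for j
  proof -
    interpret unit_interval_prob "M' j" by (rule M')
    show ?thesis using AE_unit by eventually_elim (simp add: g_def)
  qed
  have g_eq: "integral\<^sup>L (M' j) (g j) = (LINT x|M' j. cell_sum w (y j) (d j) n x)" for j
    by (rule integral_cong_AE[OF g_meas borel_measurable_integrable[OF cell_sum_integrable[OF M']] g_AE])
  have g_int: "integrable (M' j) (g j)" for j
    by (rule integrable_cong_AE_imp[OF cell_sum_integrable[OF M'] g_meas]) (use g_AE in \<open>auto simp: eq_commute\<close>)
  have "cube_integral k (PiM {..<k} M) (A_star w k y d n)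
      = (LINT x|PiM {..<k} M'. indicator (unit_cube k) x *\<^sub>R A_star w k y d n x)"
    unfolding cube_integral_def set_lebesgue_integral_def
    by (rule arg_cong[where f = "\<lambda>N. integral\<^sup>L N _"]) (auto intro!: PiM_cong simp: M'_def)
  also have "\<dots> = (LINT x|PiM {..<k} M'. (\<Prod>j<k. g j (x j)))"
  proof (intro Bochner_Integration.integral_cong refl)
    fix x assume x: "x \<in> space (PiM {..<k} M')"
    show "indicator (unit_cube k) x *\<^sub>R A_star w k y d n x = (\<Prod>j<k. g j (x j))"
    proof (cases "x \<in> unit_cube k")
      case True
      then have xj: "x j \<in> {0..1}" if "j < k" for j
        using that unfolding unit_cube_def PiE_iff by blast
      have "A_star w k y d n x = (\<Prod>j<k. cell_sum w (y j) (d j) n (x j))"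
        using d n xj by (rule A_star_eq_prod_cell_sum)
      also have "\<dots> = (\<Prod>j<k. g j (x j))"
        using xj by (intro prod.cong) (auto simp: g_def)
      finally show ?thesis using True by simp
    next
      case False
      then obtain j where "j < k" "x j \<notin> {0..1}"
        using x by (auto simp: unit_cube_def space_PiM PiE_iff)
      then have "(\<Prod>j<k. g j (x j)) = 0" by (intro prod_zero bexI[of _ j]) (auto simp: g_def)
      then show ?thesis using False by simp
    qed
  qed
  also have "\<dots> = (\<Prod>j<k. integral\<^sup>L (M' j) (g j))"
    by (rule product_integral_prod) (auto intro: g_int)
  also have "\<dots> = (\<Prod>j<k. LINT x|M j. cell_sum w (y j) (d j) n x)"
    unfolding g_eq by (intro prod.cong) (auto simp: M'_def)
  finally show ?thesis .
qed

lemma cell_sum_discrepancy_dim: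
  assumes \<nu>: "unit_interval_prob \<nu>" and \<epsilon>: "0 < \<epsilon>"
  obtains C where "0 \<le> C" "\<And>N y d. 0 < d \<Longrightarrow> d \<le> 1/2 \<Longrightarrow>
      (\<Sum>n\<in>{N..<2*N}. \<bar>(LINT x|\<nu>. cell_sum w y d n x) - (LINT x|leb01. cell_sum w y d n x)\<bar>)
        \<le> C * real N * d powr (dim_l1 \<nu> - \<epsilon>)"
proof -
  interpret unit_interval_prob \<nu> by fact
  \<comment> \<open>One \<eta> is lost in approaching the supremum and one in the divisor bound; the
    cap 1/2 keeps the dyadic series convergent.\<close>
  define \<eta> where "\<eta> = min (\<epsilon> / 2) (1/2)"
  have \<eta>: "0 < \<eta>" "\<eta> \<le> 1/2" "2 * \<eta> \<le> \<epsilon>" using \<epsilon> by (auto simp: \<eta>_def)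
  obtain s C where s: "0 \<le> s" "dim_l1 \<nu> - \<eta> < s"
    and C: "\<And>Q::real. Q \<ge> 1 \<Longrightarrow> (\<Sum>\<xi> | \<bar>real_of_int \<xi>\<bar> \<le> Q. cmod (fourier_coeff \<nu> \<xi>)) \<le> C * Q powr (1 - s)"
    using dim_l1_approx[OF \<eta>(1)] by blast
  obtain C' where C': "0 \<le> C'" "\<And>N y d. 0 < d \<Longrightarrow> d \<le> 1/2 \<Longrightarrow>
      (\<Sum>n\<in>{N..<2*N}. \<bar>(LINT x|\<nu>. cell_sum w y d n x) - (LINT x|leb01. cell_sum w y d n x)\<bar>)
        \<le> C' * real N * d powr (s - \<eta>)"
    using cell_sum_discrepancy_bound[OF \<nu> s(1) \<eta>(1,2) C] by blast
  show ?thesis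
  proof (rule that[OF C'(1)])
    fix N :: nat and y d :: real assume d: "0 < d" "d \<le> 1/2"
    have "d powr (s - \<eta>) \<le> d powr (dim_l1 \<nu> - \<epsilon>)"
      using d s \<eta> by (intro powr_mono') auto
    then have "C' * real N * d powr (s - \<eta>) \<le> C' * real N * d powr (dim_l1 \<nu> - \<epsilon>)"
      using C'(1) by (intro mult_left_mono) auto
    then show "(\<Sum>n\<in>{N..<2*N}. \<bar>(LINT x|\<nu>. cell_sum w y d n x) - (LINT x|leb01. cell_sum w y d n x)\<bar>)
        \<le> C' * real N * d powr (dim_l1 \<nu> - \<epsilon>)"
      using C'(2)[OF d, of y N] by linarith
  qed
qed

lemma A_star_discrepancy_bound:
  assumes M: "\<And>j. j < k \<Longrightarrow> unit_interval_prob (M j)" and \<epsilon>: "0 < \<epsilon>"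
  shows "\<exists>C. \<forall>(N::nat) (y::nat \<Rightarrow> real) (d::nat \<Rightarrow> real).
           (\<forall>j<k. 0 < d j \<and> d j \<le> 1/2) \<longrightarrow>
           \<bar>\<Sum>n\<in>{N..<2*N}. cube_integral k (PiM {..<k} M) (A_star w k y d n)
                          - cube_integral k (PiM {..<k} (\<lambda>_. leb01)) (A_star w k y d n)\<bar>
           \<le> C * real N powr (real k + \<epsilon>) * (\<Prod>j<k. d j powr (dim_l1 (M j) - \<epsilon>))"
proof -
  define B where "B j C \<longleftrightarrow> 0 \<le> C \<and> (\<forall>N y d. 0 < d \<longrightarrow> d \<le> 1/2 \<longrightarrow>
      (\<Sum>n\<in>{N..<2*N}. \<bar>(LINT x|M j. cell_sum w y d n x) - (LINT x|leb01. cell_sum w y d n x)\<bar>)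
        \<le> C * real N * d powr (dim_l1 (M j) - \<epsilon>))" for j C
  have "\<forall>j\<in>{..<k}. \<exists>C. B j C"
  proof
    fix j assume "j \<in> {..<k}"
    then have j: "j < k" by simp
    show "\<exists>C. B j C"
      by (rule cell_sum_discrepancy_dim[OF M[OF j] \<epsilon>]) (unfold B_def, blast)
  qed
  then obtain C where "\<forall>j\<in>{..<k}. B j (C j)" using bchoice by blast
  then have C0: "\<And>j. j < k \<Longrightarrow> 0 \<le> C j"
    and C: "\<And>j N y d. j < k \<Longrightarrow> 0 < d \<Longrightarrow> d \<le> 1/2 \<Longrightarrow>
      (\<Sum>n\<in>{N..<2*N}. \<bar>(LINT x|M j. cell_sum w y d n x) - (LINT x|leb01. cell_sum w y d n x)\<bar>)
        \<le> C j * real N * d powr (dim_l1 (M j) - \<epsilon>)"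
    by (simp_all add: B_def)
  show ?thesis
  proof (intro exI allI impI)
    fix N :: nat and y d :: "nat \<Rightarrow> real" assume d: "\<forall>j<k. 0 < d j \<and> d j \<le> 1/2"
    define I where "I j n = (LINT x|M j. cell_sum w (y j) (d j) n x)" for j n
    define J where "J j n = (LINT x|leb01. cell_sum w (y j) (d j) n x)" for j n
    \<comment> \<open>8 = 4 * 2: the zero frequency of \<open>w\<close> is at most 4, and n < 2
      N.\<close>
    define l where "l j = 8 * real N * d j" for j
    define T where "T j = C j * real N * d j powr (dim_l1 (M j) - \<epsilon>)" for j
    define D where "D = (\<Prod>j<k. d j powr (dim_l1 (M j) - \<epsilon>))"
    have pos: "0 < n" if "n \<in> {N..<2*N}" for n using that by (cases n) auto
    have "\<bar>\<Sum>n\<in>{N..<2*N}. cube_integral k (PiM {..<k} M) (A_star w k y d n)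
                          - cube_integral k (PiM {..<k} (\<lambda>_. leb01)) (A_star w k y d n)\<bar>
        \<le> (\<Sum>n\<in>{N..<2*N}. \<bar>cube_integral k (PiM {..<k} M) (A_star w k y d n)
                          - cube_integral k (PiM {..<k} (\<lambda>_. leb01)) (A_star w k y d n)\<bar>)"
      by (rule sum_abs)
    also have "\<dots> = (\<Sum>n\<in>{N..<2*N}. \<bar>(\<Prod>j<k. I j n) - (\<Prod>j<k. J j n)\<bar>)"
    proof (intro sum.cong refl)
      fix n assume n: "n \<in> {N..<2*N}"
      have "cube_integral k (PiM {..<k} M) (A_star w k y d n) = (\<Prod>j<k. I j n)"
        unfolding I_def by (rule cube_integral_A_star[OF M _ pos[OF n]]) (use d in auto)
      moreover have "cube_integral k (PiM {..<k} (\<lambda>_. leb01)) (A_star w k y d n) = (\<Prod>j<k. J j n)"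
        unfolding J_def by (rule cube_integral_A_star[OF unit_interval_prob_leb01 _ pos[OF n]]) (use d in auto)
      ultimately show "\<bar>cube_integral k (PiM {..<k} M) (A_star w k y d n)
                          - cube_integral k (PiM {..<k} (\<lambda>_. leb01)) (A_star w k y d n)\<bar>
          = \<bar>(\<Prod>j<k. I j n) - (\<Prod>j<k. J j n)\<bar>"
        by simp
    qed
    also have "\<dots> \<le> (\<Prod>j<k. l j + T j)"
    proof (rule sum_prod_diff_le)
      fix j assume j: "j < k"
      show "0 \<le> l j" using d j by (auto simp: l_def)
      show "(\<Sum>n\<in>{N..<2*N}. \<bar>I j n - J j n\<bar>) \<le> T j"
        unfolding I_def J_def T_def using d j by (intro C) auto
      fix n assume n: "n \<in> {N..<2*N}"
      have "\<bar>J j n\<bar> \<le> real n * d j * 4"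
        unfolding J_def using d j pos[OF n] by (intro abs_cell_sum_integral_leb01_le) auto
      also have "\<dots> \<le> (2 * real N) * d j * 4"
        using n d j by (intro mult_right_mono) (auto simp: less_imp_le)
      finally show "\<bar>J j n\<bar> \<le> l j" by (simp add: l_def)
    qed simp
    also have "\<dots> \<le> (\<Prod>j<k. (8 + C j) * real N * d j powr (dim_l1 (M j) - \<epsilon>))"
    proof (intro prod_mono conjI)
      fix j assume "j \<in> {..<k}"
      then have j: "j < k" and dj: "0 < d j" "d j \<le> 1/2" using d by auto
      interpret unit_interval_prob "M j" by (rule M[OF j])
      show "0 \<le> l j + T j" using dj C0[OF j] by (simp add: l_def T_def)
      \<comment> \<open>Since d_j \<le> 1, a smaller exponent gives a larger power, so
        \<open>l j\<close> is absorbed into the shape of \<open>T j\<close>.\<close>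
      have "d j powr 1 \<le> d j powr (dim_l1 (M j) - \<epsilon>)"
        using dj dim_l1_le_1 \<epsilon> by (intro powr_mono') auto
      then have "8 * real N * d j \<le> 8 * real N * d j powr (dim_l1 (M j) - \<epsilon>)"
        using dj by (intro mult_left_mono) auto
      then show "l j + T j \<le> (8 + C j) * real N * d j powr (dim_l1 (M j) - \<epsilon>)"
        by (simp add: l_def T_def algebra_simps)
    qed
    also have "\<dots> = (\<Prod>j<k. 8 + C j) * real N ^ k * D"
      by (simp add: prod.distrib D_def)
    finally have main: "\<bar>\<Sum>n\<in>{N..<2*N}. cube_integral k (PiM {..<k} M) (A_star w k y d n)
                          - cube_integral k (PiM {..<k} (\<lambda>_. leb01)) (A_star w k y d n)\<bar>
        \<le> (\<Prod>j<k. 8 + C j) * real N ^ k * D" .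
    have D0: "0 \<le> D" unfolding D_def by (simp add: prod_nonneg)
    have P0: "0 \<le> (\<Prod>j<k. 8 + C j)" using C0 by (intro prod_nonneg) (auto simp: add_nonneg_nonneg)
    show "\<bar>\<Sum>n\<in>{N..<2*N}. cube_integral k (PiM {..<k} M) (A_star w k y d n)
                          - cube_integral k (PiM {..<k} (\<lambda>_. leb01)) (A_star w k y d n)\<bar>
        \<le> (\<Prod>j<k. 8 + C j) * real N powr (real k + \<epsilon>) * (\<Prod>j<k. d j powr (dim_l1 (M j) - \<epsilon>))"
    \<comment> \<open>For N = 0 the sum is empty and \<open>0 powr _\<close> is 0; the comparison of
      N^k with N^(k + \<epsilon>) uses N \<ge> 1.\<close>
    proof (cases "N = 0")
      case True
      then show ?thesis by simp
    next
      case False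
      then have "real N ^ k \<le> real N powr (real k + \<epsilon>)"
        using \<epsilon> by (simp add: powr_realpow[symmetric] powr_mono)
      then have "(\<Prod>j<k. 8 + C j) * real N ^ k * D \<le> (\<Prod>j<k. 8 + C j) * real N powr (real k + \<epsilon>) * D"
        using D0 P0 by (intro mult_right_mono mult_left_mono) auto
      then show ?thesis using main unfolding D_def by linarith
    qed
  qed
qed

end

theorem theorem3p1:
  fixes k :: nat and w :: "real \<Rightarrow> real" and M :: "nat \<Rightarrow> real measure"
    and \<kappa> :: "nat \<Rightarrow> real"
  assumes w_smooth: "smooth_real w"
    and w_range: "\<And>x. 0 \<le> w x \<and> w x \<le> 1"
    and w_supp: "\<And>x. x \<notin> {-2..2} \<Longrightarrow> w x = 0"
    and w_nonzero: "\<exists>x. w x \<noteq> 0"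
    and M_borel: "\<And>j. j < k \<Longrightarrow> sets (M j) = sets borel"
    and M_prob: "\<And>j. j < k \<Longrightarrow> prob_space (M j)"
    and M_supp: "\<And>j. j < k \<Longrightarrow> measure (M j) {0..1} = 1"
    and M_dim: "\<And>j. j < k \<Longrightarrow> dim_l1 (M j) = \<kappa> j"
  shows "\<forall>\<epsilon>>0. \<exists>C. \<forall>(N::nat) (y::nat \<Rightarrow> real) (d::nat \<Rightarrow> real).
           (\<forall>j<k. 0 < d j \<and> d j \<le> 1/2) \<longrightarrow>
           \<bar>\<Sum>n\<in>{N..<2*N}. cube_integral k (PiM {..<k} M) (A_star w k y d n)
                          - cube_integral k (PiM {..<k} (\<lambda>_. leb01)) (A_star w k y d n)\<bar>
           \<le> C * real N powr (real k + \<epsilon>) * (\<Prod>j<k. d j powr (\<kappa> j - \<epsilon>))"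
proof -
  have supp: "w x = 0" if "2 < \<bar>x\<bar>" for x
    using that by (intro w_supp) auto
  obtain L A where "0 \<le> A" "\<And>x y. \<bar>w x - w y\<bar> \<le> L * \<bar>x - y\<bar>"
    "\<And>\<xi>. \<xi> \<noteq> 0 \<Longrightarrow> norm (fourier_transform w \<xi>) \<le> A * min 1 (1 / \<xi>\<^sup>2)"
    using smooth_compact_support_bounds[where R = 2, OF w_smooth supp] by (metis zero_le_numeral)
  then interpret test_function w L A
    using w_range supp by unfold_locales auto
  have M: "unit_interval_prob (M j)" if "j < k" for j
    using that by (intro unit_interval_prob_borel M_borel M_prob M_supp)
  have dim: "(\<Prod>j<k. d j powr (dim_l1 (M j) - \<epsilon>)) = (\<Prod>j<k. d j powr (\<kappa> j - \<epsilon>))" for d and \<epsilon> :: real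
    using M_dim by (intro prod.cong) auto
  show ?thesis
    unfolding dim[symmetric] by (intro allI impI A_star_discrepancy_bound M)
qed

end
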